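(* Let $G_{\mathbb{C}}=G_2(\mathbb{C})$, $H_{\mathbb{C}}=SL(3,\mathbb{C})=\{g\in G_2(\mathbb{C}):ge_1=e_1\}$ and $G_u=G_2$, with Lie algebras $\mathfrak{g},\mathfrak{h},\mathfrak{g}_u$, and let $\mathfrak{q}$ be the orthogonal complement of $\mathfrak{h}$ in $\mathfrak{g}$ with respect to the Killing form of $\mathfrak{g}$. Let $\mathfrak{a}_1=\{\tau_t:t\in\mathbb{R}\}$ be the one-dimensional real space of $8\times 8$ matrices $\tau_t=\operatorname{diag}(\delta_{(0,t)},\delta_{(-t/2,-t/2)})$. Then $\mathfrak{a}_1\subset\sqrt{-1}\,\mathfrak{g}_u\cap\mathfrak{q}$, and the one-dimensional abelian group $A_1=\exp\mathfrak{a}_1$ satisfies $$G_{\mathbb{C}}=G_uA_1H_{\mathbb{C}}.$$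
   Context: Cayley algebra: $\mathfrak{C}$ is the 8-dimensional real algebra with basis $e_0,\dots,e_7$, where $e_0$ is the unit, $e_i^2=-e_0$ for $i\ge 1$, $e_ie_j=-e_je_i$ for distinct $i,j\geq 1$, and $e_1e_2=e_3$, $e_1e_4=e_5$, $e_1e_6=e_7$, $e_2e_5=e_7$, $e_2e_6=e_4$, $e_3e_5=e_6$, $e_3e_4=e_7$ (each listed relation $e_ie_j=e_k$ also gives $e_je_k=e_i$ and $e_ke_i=e_j$). $\mathfrak{C}_{\mathbb{C}}=\mathfrak{C}\otimes_{\mathbb{R}}\mathbb{C}$ carries the complex symmetric bilinear form with $(e_i,e_j)=\delta_{ij}$. $SO(8,\mathbb{C})=\{g\in SL(8,\mathbb{C}):{}^tgg=I_8\}$ acts on $\mathfrak{C}_{\mathbb{C}}$ via the ordered basis $e_0,\dots,e_7$; $SO(8)$ is its subgroup of real matrices. $G_2(\mathbb{C})=\{g\in SO(8,\mathbb{C}):(gx)(gy)=g(xy)\ \forall x,y\in\mathfrak{C}_{\mathbb{C}}\}$, and $G_2=\{g\in SO(8):(gx)(gy)=g(xy)\ \forall x,y\in\mathfrak{C}\}$, the fixed point group of the Cartan involution $g\mapsto\overline{g}$ of $G_2(\mathbb{C})$. For $x,y\in\mathbb{R}$, $$\delta_{(x,y)}=\begin{pmatrix}0&0&0&-\sqrt{-1}x\\0&0&-\sqrt{-1}y&0\\0&\sqrt{-1}y&0&0\\\sqrt{-1}x&0&0&0\end{pmatrix}.$$ Here $\operatorname{diag}$ denotes a block-diagonal matrix.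 *)

theory Defs
  imports "HOL-Analysis.Analysis" "HOL-Algebra.Group"
begin

section \<open>The Cayley algebra\<close>

text \<open>
  The elements of the finite type \<open>8\<close> are \<open>0, ..., 7\<close>, so \<open>axis i 1\<close> is the basis vector \<open>e_i\<close>
  and matrices of type \<open>complex^8^8\<close> are taken with respect to the ordered basis \<open>e_0, ..., e_7\<close>.
\<close>

definition cayley_triples :: "(8 \<times> 8 \<times> 8) set" where
  "cayley_triples = {(1,2,3), (1,4,5), (1,6,7), (2,5,7), (2,6,4), (3,5,6), (3,4,7)}"

definition cayley_cyclic :: "8 \<Rightarrow> 8 \<Rightarrow> 8 \<Rightarrow> bool" where
  "cayley_cyclic i j k \<longleftrightarrow>
     (i, j, k) \<in> cayley_triples \<or> (j, k, i) \<in> cayley_triples \<or> (k, i, j) \<in> cayley_triples"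

text \<open>\<open>cayley_coeff i j k\<close> is the coefficient of \<open>e_k\<close> in \<open>e_i e_j\<close>.\<close>

definition cayley_coeff :: "8 \<Rightarrow> 8 \<Rightarrow> 8 \<Rightarrow> int" where
  "cayley_coeff i j k =
     (if i = 0 then (if k = j then 1 else 0)
      else if j = 0 then (if k = i then 1 else 0)
      else if i = j then (if k = 0 then - 1 else 0)
      else if cayley_cyclic i j k then 1
      else if cayley_cyclic j i k then - 1
      else 0)"

definition cayley_mult :: "'a::comm_ring_1^8 \<Rightarrow> 'a^8 \<Rightarrow> 'a^8" where
  "cayley_mult x y = (\<chi> k. \<Sum>i\<in>UNIV. \<Sum>j\<in>UNIV. of_int (cayley_coeff i j k) * x $ i * y $ j)"

text \<open>The complexified algebra is \<open>complex^8\<close> with \<^const>\<open>cayley_mult\<close>;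
  the real form is the set of vectors with real coordinates.\<close>

definition cayley_real :: "(complex^8) set" where
  "cayley_real = {x. \<forall>i. x $ i \<in> \<real>}"

lemma cayley_mult_axis:
  "cayley_mult (axis i 1) (axis j 1) = ((\<chi> k. of_int (cayley_coeff i j k)) :: 'a::comm_ring_1^8)"
proof -
  have "(\<Sum>a\<in>UNIV. \<Sum>b\<in>UNIV. of_int (cayley_coeff a b k) * axis i 1 $ a * axis j 1 $ b)
          = (of_int (cayley_coeff i j k) :: 'a)" for k
  proof -
    have "(\<Sum>a\<in>UNIV. \<Sum>b\<in>UNIV. of_int (cayley_coeff a b k) * axis i 1 $ a * axis j 1 $ b)
          = (\<Sum>a\<in>UNIV. \<Sum>b\<in>UNIV. if b = j then (if a = i then of_int (cayley_coeff a b k) else 0)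
                else (0 :: 'a))"
      by (intro sum.cong refl) (auto simp: axis_def)
    then show ?thesis by (simp add: sum.delta)
  qed
  then show ?thesis by (simp add: cayley_mult_def vec_eq_iff)
qed

lemma cayley_mult_triples:
  assumes "(i, j, k) \<in> cayley_triples"
  shows "cayley_mult (axis i 1) (axis j 1) = (axis k 1 :: 'a::comm_ring_1^8)"
    and "cayley_mult (axis j 1) (axis k 1) = (axis i 1 :: 'a::comm_ring_1^8)"
    and "cayley_mult (axis k 1) (axis i 1) = (axis j 1 :: 'a::comm_ring_1^8)"
    and "cayley_mult (axis j 1) (axis i 1) = - (axis k 1 :: 'a::comm_ring_1^8)"
proof -
  note [simp] = cayley_coeff_def cayley_cyclic_def cayley_triples_def
  have c: "cayley_coeff i j l = (if l = k then 1 else 0) \<and>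
      cayley_coeff j k l = (if l = i then 1 else 0) \<and>
      cayley_coeff k i l = (if l = j then 1 else 0) \<and>
      cayley_coeff j i l = (if l = k then - 1 else 0)" for l
    using assms
    by (simp only: cayley_triples_def insert_iff empty_iff prod.inject) (elim disjE conjE; simp)
  show "cayley_mult (axis i 1) (axis j 1) = (axis k 1 :: 'a::comm_ring_1^8)"
    and "cayley_mult (axis j 1) (axis k 1) = (axis i 1 :: 'a::comm_ring_1^8)"
    and "cayley_mult (axis k 1) (axis i 1) = (axis j 1 :: 'a::comm_ring_1^8)"
    and "cayley_mult (axis j 1) (axis i 1) = - (axis k 1 :: 'a::comm_ring_1^8)"
    unfolding cayley_mult_axis using c by (simp_all add: vec_eq_iff axis_def del: cayley_coeff_def)
qed


section \<open>The groups\<close>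

definition SO8C :: "(complex^8^8) set" where
  "SO8C = {g. det g = 1 \<and> transpose g ** g = mat 1}"

definition SO8 :: "(complex^8^8) set" where
  "SO8 = {g \<in> SO8C. \<forall>i j. g $ i $ j \<in> \<real>}"

definition G2C :: "(complex^8^8) set" where
  "G2C = {g \<in> SO8C. \<forall>x y. cayley_mult (g *v x) (g *v y) = g *v cayley_mult x y}"

definition G2 :: "(complex^8^8) set" where
  "G2 = {g \<in> SO8. \<forall>x\<in>cayley_real. \<forall>y\<in>cayley_real.
           cayley_mult (g *v x) (g *v y) = g *v cayley_mult x y}"

definition SL3C :: "(complex^8^8) set" where
  "SL3C = {g \<in> G2C. g *v axis 1 1 = axis 1 1}"


section \<open>Matrix exponential and Lie algebras of matrix groups\<close>

definition mpow :: "complex^'n^'n \<Rightarrow> nat \<Rightarrow> complex^'n^'n" where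
  "mpow A k = (((**) A) ^^ k) (mat 1)"

definition mexp :: "complex^'n^'n \<Rightarrow> complex^'n^'n" where
  "mexp A = (\<Sum>k. (1 / fact k) *\<^sub>R mpow A k)"

definition lie_algebra :: "(complex^'n^'n) set \<Rightarrow> (complex^'n^'n) set" where
  "lie_algebra G = {X. \<forall>t::real. mexp (t *\<^sub>R X) \<in> G}"

definition bracket :: "complex^'n^'n \<Rightarrow> complex^'n^'n \<Rightarrow> complex^'n^'n" where
  "bracket X Y = X ** Y - Y ** X"


section \<open>The Killing form\<close>

definition mscale :: "complex \<Rightarrow> complex^'n^'m \<Rightarrow> complex^'n^'m" where
  "mscale c A = (\<chi> i j. c * A $ i $ j)"

global_interpretation cmat: vector_space "mscale :: complex \<Rightarrow> complex^'n^'m \<Rightarrow> complex^'n^'m"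
  by unfold_locales (simp_all add: mscale_def vec_eq_iff algebra_simps)

text \<open>
  Trace of a complex linear endomorphism \<open>f\<close> of a complex subspace \<open>V\<close> of the matrix space,
  computed in a complex basis of \<open>V\<close>; the value does not depend on the basis chosen.
\<close>

definition trace_on :: "(complex^'n^'m) set \<Rightarrow> (complex^'n^'m \<Rightarrow> complex^'n^'m) \<Rightarrow> complex" where
  "trace_on V f =
     (let B = (SOME B. \<not> cmat.dependent B \<and> cmat.span B = V)
      in \<Sum>b\<in>B. cmat.representation B (f b) b)"

definition killing_form :: "(complex^'n^'n) set \<Rightarrow> complex^'n^'n \<Rightarrow> complex^'n^'n \<Rightarrow> complex" where
  "killing_form L X Y = trace_on L (\<lambda>Z. bracket X (bracket Y Z))"

definition killing_complement ::
    "(complex^'n^'n) set \<Rightarrow> (complex^'n^'n) set \<Rightarrow> (complex^'n^'n) set" where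
  "killing_complement L M = {X \<in> L. \<forall>Y\<in>M. killing_form L X Y = 0}"


section \<open>The abelian part\<close>

text \<open>The elements of type \<open>4\<close> are \<open>0, ..., 3\<close>; rows and columns are counted from \<open>0\<close>.\<close>

definition delta :: "real \<Rightarrow> real \<Rightarrow> complex^4^4" where
  "delta x y = (\<chi> r c.
     if (r, c) = (0, 3) then - \<i> * of_real x
     else if (r, c) = (1, 2) then - \<i> * of_real y
     else if (r, c) = (2, 1) then \<i> * of_real y
     else if (r, c) = (3, 0) then \<i> * of_real x
     else 0)"

definition idx8 :: "8 \<Rightarrow> nat" where
  "idx8 i = (LEAST n. of_nat n = i)"

lemma idx8_simps [simp]:
  "idx8 0 = 0" "idx8 1 = 1" "idx8 2 = 2" "idx8 3 = 3"
  "idx8 4 = 4" "idx8 5 = 5" "idx8 6 = 6" "idx8 7 = 7"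
proof -
  have "idx8 (of_nat m) = m" if "m < 8" for m
    unfolding idx8_def
  proof (rule Least_equality)
    fix n assume "(of_nat n :: 8) = of_nat m"
    then have "(Abs_bit0 (int n mod 8) :: 8) = Abs_bit0 (int m mod 8)"
      by (simp add: bit0.of_nat_eq)
    then have "int n mod 8 = int m mod 8"
      by (subst (asm) Abs_bit0_inject) auto
    then have "n mod 8 = m mod 8"
      by (metis of_nat_eq_iff of_nat_mod of_nat_numeral)
    with that show "m \<le> n" by (metis mod_less mod_less_eq_dividend)
  qed simp
  from this[of 0] this[of 1] this[of 2] this[of 3] this[of 4] this[of 5] this[of 6] this[of 7]
  show "idx8 0 = 0" "idx8 1 = 1" "idx8 2 = 2" "idx8 3 = 3"
    "idx8 4 = 4" "idx8 5 = 5" "idx8 6 = 6" "idx8 7 = 7"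
    by simp_all
qed

definition diag2 :: "complex^4^4 \<Rightarrow> complex^4^4 \<Rightarrow> complex^8^8" where
  "diag2 A B = (\<chi> i j.
     if idx8 i < 4 \<and> idx8 j < 4 then A $ of_nat (idx8 i) $ of_nat (idx8 j)
     else if idx8 i \<ge> 4 \<and> idx8 j \<ge> 4 then B $ of_nat (idx8 i - 4) $ of_nat (idx8 j - 4)
     else 0)"

definition tau :: "real \<Rightarrow> complex^8^8" where
  "tau t = diag2 (delta 0 t) (delta (- t / 2) (- t / 2))"

definition \<aa>\<^sub>1 :: "(complex^8^8) set" where
  "\<aa>\<^sub>1 = range tau"

definition A\<^sub>1 :: "(complex^8^8) set" where
  "A\<^sub>1 = mexp ` \<aa>\<^sub>1"

end

theory Submission
  imports Defs
begin

text \<open>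
  A group element \<open>g\<close> is determined modulo \<open>SL(3, \<complex>)\<close> by the vector \<open>g e_1\<close>, which is imaginary of
  square 1, say \<open>a + \<i> b\<close> with \<open>a\<close>, \<open>b\<close> real, orthogonal and \<open>|a|\<^sup>2 - |b|\<^sup>2 = 1\<close>. The compact group is
  transitive on pairs of orthogonal directions, so it moves this vector to
  \<open>cosh t e_1 + \<i> sinh t e_2 = exp \<tau>_t e_1\<close>, which gives the decomposition. Orthogonality of \<open>\<tau>_t\<close> to
  the Lie algebra of \<open>SL(3, \<complex>)\<close> follows by averaging over the centre of \<open>SL(3, \<complex>)\<close>, of order 3: the Killing
  form is invariant, the centre commutes with the subalgebra, and the three conjugates of \<open>\<tau>_t\<close>
  have sum 0.
\<close>

section \<open>The matrix exponential as a flow\<close>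

text \<open>A Lie algebra is here the set of matrices whose real multiples all have exponentials in
  the group; from this form not even closure under addition is visible. The bridge is the flow
  equation y' = A y: its only solution from x is \<open>mexp (t *\<^sub>R A) *v x\<close>, so
  identities between exponentials are obtained by differentiating, and the Lie algebra of
  \<open>G2C\<close> becomes the linear space of skew derivations. The Killing form is a trace in an
  unspecified basis, and no basis of this space is ever exhibited. Averaging suits this situation:
  besides linear algebra in coordinates it asks of the trace only additivity and tr(fg) = tr(gf).
  For transitivity, the derivations that vanish on a quaternion subalgebra spanned by basis vectors
  collapse the four remaining coordinates onto one. The index sets {4,5,6,7}, {2,3,4,5}, {1,2,5,6}
  overlap so that three collapses reduce seven coordinates to the first. The first two sets avoid 1,
  so the same two collapses serve again for the second vector of the pair while e_1 stays
  fixed.\<close>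

lemma has_vector_derivative_vec:
  fixes f :: "real \<Rightarrow> 'a::real_normed_vector^'n"
  assumes "\<And>i. ((\<lambda>x. f x $ i) has_vector_derivative f' $ i) (at t)"
  shows "(f has_vector_derivative f') (at t)"
  using assms unfolding has_vector_derivative_def has_derivative_def
  by (auto intro!: vec_tendstoI bounded_linear_scaleR_left)

lemma sums_vec:
  fixes f :: "nat \<Rightarrow> 'a::real_normed_vector^'n"
  assumes "\<And>i. (\<lambda>k. f k $ i) sums (s $ i)"
  shows "f sums s"
  using assms unfolding sums_def by (auto intro!: vec_tendstoI)

lemma bounded_bilinear_matrix_mult:
  "bounded_bilinear ((**) :: complex^'m^'n \<Rightarrow> complex^'k^'m \<Rightarrow> complex^'k^'n)"
  unfolding bilinear_conv_bounded_bilinear [symmetric] bilinear_def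
  by (auto intro!: linearI simp: matrix_add_ldistrib matrix_matrix_mult_def vec_eq_iff
      algebra_simps sum.distrib scaleR_sum_right)

lemma bounded_bilinear_matrix_vector_mult:
  "bounded_bilinear ((*v) :: complex^'m^'n \<Rightarrow> complex^'m \<Rightarrow> complex^'n)"
  unfolding bilinear_conv_bounded_bilinear [symmetric] bilinear_def
  by (auto intro!: linearI simp: matrix_vector_mult_def vec_eq_iff
      algebra_simps sum.distrib scaleR_sum_right)

lemma mpow_0 [simp]: "mpow A 0 = mat 1"
  and mpow_Suc: "mpow A (Suc k) = A ** mpow A k"
  by (simp_all add: mpow_def)

lemma mpow_Suc2: "mpow A (Suc k) = mpow A k ** A"
proof (induction k)
  case (Suc k)
  then show ?case by (metis mpow_Suc matrix_mul_assoc)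
qed (simp add: mpow_Suc)

lemma
  fixes A :: "complex^'m^'n" and B :: "complex^'k^'m"
  shows matrix_mult_uminus_left: "(- A) ** B = - (A ** B)"
    and matrix_mult_uminus_right: "A ** (- B) = - (A ** B)"
    and matrix_vector_mult_uminus_left: "(- A) *v x = - (A *v x)"
  by (simp_all add: matrix_matrix_mult_def matrix_vector_mult_def vec_eq_iff sum_negf)

lemma mpow_mscale: "mpow (mscale z A) k = mscale (z ^ k) (mpow A k)"
  by (induction k)
    (auto simp: mpow_Suc mscale_def matrix_matrix_mult_def vec_eq_iff sum_distrib_left
      algebra_simps intro!: sum.cong)

text \<open>Every entry of A is at most \<open>norm A\<close>, and each multiplication by A sums
  CARD('n) products. The bound is crude but geometric, so the factorials dominate it.\<close>

lemma norm_mpow_nth_le: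
  fixes A :: "complex^'n^'n"
  shows "cmod (mpow A k $ i $ j) \<le> (real CARD('n) * norm A) ^ k"
proof (induction k arbitrary: i)
  case 0
  then show ?case by (simp add: mat_def)
next
  case (Suc k)
  have "cmod (mpow A (Suc k) $ i $ j) \<le> (\<Sum>l\<in>UNIV. cmod (A $ i $ l * mpow A k $ l $ j))"
    by (simp add: mpow_Suc matrix_matrix_mult_def norm_sum)
  also have "\<dots> \<le> (\<Sum>l\<in>(UNIV::'n set). norm A * (real CARD('n) * norm A) ^ k)"
  proof (rule sum_mono)
    fix l
    have "cmod (A $ i $ l) \<le> norm A"
      by (meson Finite_Cartesian_Product.norm_nth_le order_trans)
    then show "cmod (A $ i $ l * mpow A k $ l $ j) \<le> norm A * (real CARD('n) * norm A) ^ k"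
      unfolding norm_mult by (intro mult_mono Suc) auto
  qed
  finally show ?case by simp
qed

lemma summable_mexp:
  fixes A :: "complex^'n^'n"
  shows "summable (\<lambda>k. mpow A k $ i $ j / fact k * z ^ k)"
proof (rule summable_comparison_test')
  show "summable (\<lambda>k. (real CARD('n) * norm A * cmod z) ^ k /\<^sub>R fact k)"
    by (rule summable_exp_generic)
  fix k :: nat
  have "cmod (mpow A k $ i $ j) * cmod z ^ k \<le> (real CARD('n) * norm A) ^ k * cmod z ^ k"
    by (intro mult_right_mono norm_mpow_nth_le) auto
  then show "cmod (mpow A k $ i $ j / fact k * z ^ k) \<le> (real CARD('n) * norm A * cmod z) ^ k /\<^sub>R fact k"
    by (simp add: norm_mult norm_divide norm_power power_mult_distrib divide_simps)
qed

text \<open>With a complex scalar z each entry becomes an everywhere convergent power series in one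
  complex variable, which can be differentiated term by term; real time is recovered afterwards
  through \<open>of_real\<close>.\<close>

lemma mexp_nth:
  fixes A :: "complex^'n^'n"
  shows "mexp (mscale z A) $ i $ j = (\<Sum>k. mpow A k $ i $ j / fact k * z ^ k)"
proof -
  define E where "E = (\<chi> i j. \<Sum>k. mpow A k $ i $ j / fact k * z ^ k)"
  have "(\<lambda>k. (1 / fact k) *\<^sub>R mpow (mscale z A) k) sums E"
  proof (intro sums_vec)
    fix i j
    show "(\<lambda>k. ((1 / fact k) *\<^sub>R mpow (mscale z A) k) $ i $ j) sums (E $ i $ j)"
      using summable_sums [OF summable_mexp [of A i j z]]
      by (simp add: E_def mpow_mscale) (simp add: mscale_def scaleR_conv_of_real field_simps)
  qed
  then show ?thesis
    unfolding mexp_def by (simp add: sums_iff E_def)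
qed

lemma scaleR_eq_mscale: "t *\<^sub>R A = mscale (of_real t) A"
  unfolding mscale_def vec_eq_iff vector_scaleR_component
  by (simp add: scaleR_conv_of_real [where 'a = complex])

lemma mexp_0 [simp]: "mexp (0 :: complex^'n^'n) = mat 1"
proof -
  have "mexp (mscale 0 (0 :: complex^'n^'n)) $ i $ j = mat 1 $ i $ j" for i j
    unfolding mexp_nth powser_zero by simp
  moreover have "mscale 0 (0 :: complex^'n^'n) = 0"
    by simp
  ultimately show ?thesis by (metis vec_eq_iff)
qed

lemma matrix_mult_mexp_commute: "A ** mexp (mscale z A) = mexp (mscale z A) ** A"
proof -
  have "(\<Sum>l\<in>UNIV. A $ i $ l * mexp (mscale z A) $ l $ j)
      = (\<Sum>k. \<Sum>l\<in>UNIV. A $ i $ l * (mpow A k $ l $ j / fact k * z ^ k))" for i j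
    unfolding mexp_nth by (subst suminf_sum) (auto intro!: sum.cong summable_mult summable_mexp suminf_mult [symmetric]
        simp del: times_divide_eq_left times_divide_eq_right)
  moreover have "(\<Sum>l\<in>UNIV. mexp (mscale z A) $ i $ l * A $ l $ j)
      = (\<Sum>k. \<Sum>l\<in>UNIV. (mpow A k $ i $ l / fact k * z ^ k) * A $ l $ j)" for i j
    unfolding mexp_nth by (subst suminf_sum) (auto intro!: sum.cong summable_mult2 summable_mexp suminf_mult2
        simp del: times_divide_eq_left times_divide_eq_right)
  moreover have "(\<Sum>l\<in>UNIV. A $ i $ l * (mpow A k $ l $ j / fact k * z ^ k))
      = (\<Sum>l\<in>UNIV. (mpow A k $ i $ l / fact k * z ^ k) * A $ l $ j)" for i j k
  proof -
    have "(\<Sum>l\<in>UNIV. A $ i $ l * (mpow A k $ l $ j / fact k * z ^ k)) = (A ** mpow A k) $ i $ j * (z ^ k / fact k)"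
      unfolding matrix_matrix_mult_def vec_lambda_beta sum_distrib_right by (auto intro!: sum.cong)
    also have "\<dots> = (mpow A k ** A) $ i $ j * (z ^ k / fact k)"
      by (metis mpow_Suc mpow_Suc2)
    also have "\<dots> = (\<Sum>l\<in>UNIV. (mpow A k $ i $ l / fact k * z ^ k) * A $ l $ j)"
      unfolding matrix_matrix_mult_def vec_lambda_beta sum_distrib_right by (auto intro!: sum.cong)
    finally show ?thesis .
  qed
  ultimately show ?thesis
    by (simp add: vec_eq_iff matrix_matrix_mult_def)
qed

lemma mexp_nth_has_field_derivative:
  "((\<lambda>z. mexp (mscale z A) $ i $ j) has_field_derivative (A ** mexp (mscale z A)) $ i $ j) (at z)"
proof -
  have "((\<lambda>z. \<Sum>k. mpow A k $ i $ j / fact k * z ^ k) has_field_derivative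
      (\<Sum>k. diffs (\<lambda>k. mpow A k $ i $ j / fact k) k * z ^ k)) (at z)"
    by (rule termdiffs_strong_converges_everywhere) (rule summable_mexp)
  moreover have "diffs (\<lambda>k. mpow A k $ i $ j / fact k) k * z ^ k
      = (\<Sum>l\<in>UNIV. A $ i $ l * (mpow A k $ l $ j / fact k * z ^ k))" for k
  proof -
    have "diffs (\<lambda>k. mpow A k $ i $ j / fact k) k * z ^ k = (A ** mpow A k) $ i $ j * (z ^ k / fact k)"
      by (simp add: diffs_def mpow_Suc field_simps del: of_nat_Suc)
    also have "\<dots> = (\<Sum>l\<in>UNIV. A $ i $ l * (mpow A k $ l $ j / fact k * z ^ k))"
      unfolding matrix_matrix_mult_def vec_lambda_beta sum_distrib_right by (auto intro!: sum.cong)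
    finally show ?thesis .
  qed
  moreover have "(\<Sum>k. \<Sum>l\<in>UNIV. A $ i $ l * (mpow A k $ l $ j / fact k * z ^ k))
      = (A ** mexp (mscale z A)) $ i $ j"
    unfolding matrix_matrix_mult_def
    by (subst suminf_sum)
      (auto simp: mexp_nth intro!: sum.cong summable_mult summable_mexp suminf_mult
        simp del: times_divide_eq_left times_divide_eq_right)
  ultimately show ?thesis
    by (simp add: mexp_nth)
qed

section \<open>The flow equation and uniqueness of its solutions\<close>

lemma mexp_has_vector_derivative:
  "((\<lambda>t. mexp (t *\<^sub>R A)) has_vector_derivative A ** mexp (t *\<^sub>R A)) (at t)"
proof (intro has_vector_derivative_vec)
  fix i j
  have "((\<lambda>t. complex_of_real t) has_vector_derivative 1) (at t)"
    using has_vector_derivative_of_real [OF DERIV_ident] by simp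
  from field_vector_diff_chain_at [OF this mexp_nth_has_field_derivative]
  show "((\<lambda>t. mexp (t *\<^sub>R A) $ i $ j) has_vector_derivative (A ** mexp (t *\<^sub>R A)) $ i $ j) (at t)"
    by (simp add: o_def scaleR_eq_mscale)
qed

text \<open>A commutes with its exponential and is written on the right here, so that it meets the A
  of y' = A y when exp(-tA) y is differentiated.\<close>

lemma mexp_uminus_has_vector_derivative:
  "((\<lambda>t. mexp (- t *\<^sub>R A)) has_vector_derivative - (mexp (- t *\<^sub>R A) ** A)) (at t)"
proof -
  have "((\<lambda>t. - t) has_vector_derivative - 1) (at t)"
    by (auto intro!: derivative_eq_intros)
  from vector_diff_chain_at [OF this mexp_has_vector_derivative [of A]]
  show ?thesis
    using matrix_mult_mexp_commute [of A "of_real (- t)"]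
    by (simp add: o_def scaleR_eq_mscale [symmetric] del: of_real_minus)
qed

text \<open>The left side has derivative - exp(-tA) A y + exp(-tA) A y = 0, hence equals its value
  at time 0.\<close>

lemma mexp_inverse_ode:
  fixes y :: "real \<Rightarrow> complex^'n"
  assumes y: "\<And>t. (y has_vector_derivative A *v y t) (at t)"
  shows "mexp (- t *\<^sub>R A) *v y t = y 0"
proof -
  have "((\<lambda>t. mexp (- t *\<^sub>R A) *v y t) has_vector_derivative 0) (at t)" for t
    using bounded_bilinear.has_vector_derivative [OF bounded_bilinear_matrix_vector_mult
        mexp_uminus_has_vector_derivative [of A] y]
    by (simp add: matrix_vector_mul_assoc matrix_mult_uminus_left matrix_vector_mult_uminus_left)
  then obtain c where "\<And>t. mexp (- t *\<^sub>R A) *v y t = c"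
    by (rule has_vector_derivative_zero_constant [OF convex_UNIV]) auto
  from this [of t] this [of 0] show ?thesis by simp
qed

lemma mexp_inverse: "mexp (- t *\<^sub>R A) ** mexp (t *\<^sub>R A) = mat 1"
proof -
  have "mexp (- t *\<^sub>R A) *v (mexp (t *\<^sub>R A) *v x) = mexp (0 *\<^sub>R A) *v x" for x
    by (intro mexp_inverse_ode)
      (use bounded_bilinear.has_vector_derivative [OF bounded_bilinear_matrix_vector_mult
        mexp_has_vector_derivative has_vector_derivative_const] in \<open>simp add: matrix_vector_mul_assoc\<close>)
  then show ?thesis
    by (simp add: matrix_eq matrix_vector_mul_assoc)
qed

text \<open>Uniqueness for y' = A y, by cancelling exp(-tA) in the conserved quantity. The later
  identities for exponentials come from choosing a suitable curve y.\<close>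

theorem mexp_ode:
  fixes y :: "real \<Rightarrow> complex^'n"
  assumes "\<And>t. (y has_vector_derivative A *v y t) (at t)"
  shows "y t = mexp (t *\<^sub>R A) *v y 0"
proof -
  have "mexp (t *\<^sub>R A) *v (mexp (- t *\<^sub>R A) *v y t) = mexp (t *\<^sub>R A) *v y 0"
    by (simp only: mexp_inverse_ode [OF assms])
  then show ?thesis
    using mexp_inverse [of "- t" A] by (simp add: matrix_vector_mul_assoc)
qed

lemma mexp_vector_has_vector_derivative:
  "((\<lambda>t. mexp (t *\<^sub>R A) *v x) has_vector_derivative A *v (mexp (t *\<^sub>R A) *v x)) (at t)"
  using bounded_bilinear.has_vector_derivative [OF bounded_bilinear_matrix_vector_mult
      mexp_has_vector_derivative has_vector_derivative_const]
  by (simp add: matrix_vector_mul_assoc)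

lemma mexp_add: "mexp ((s + t) *\<^sub>R A) = mexp (s *\<^sub>R A) ** mexp (t *\<^sub>R A)"
proof -
  have "((\<lambda>s. mexp ((s + t) *\<^sub>R A) *v x) has_vector_derivative
      A *v (mexp ((s + t) *\<^sub>R A) *v x)) (at s)" for x s
  proof -
    have "((\<lambda>s. s + t) has_vector_derivative 1) (at s)"
      by (auto intro!: derivative_eq_intros)
    from vector_diff_chain_at [OF this mexp_vector_has_vector_derivative]
    show ?thesis by (simp add: o_def)
  qed
  from mexp_ode [OF this] show ?thesis
    by (simp add: matrix_eq matrix_vector_mul_assoc)
qed

text \<open>The transpose of exp(-tA) satisfies the flow equation of - transpose A = A, and it
  starts at the identity.\<close>

lemma transpose_mexp:
  assumes A: "transpose A = - A"
  shows "transpose (mexp (t *\<^sub>R A)) = mexp (- t *\<^sub>R A)"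
proof -
  have tr: "bounded_linear (transpose :: complex^'n^'n \<Rightarrow> complex^'n^'n)"
    unfolding linear_conv_bounded_linear [symmetric]
    by (auto intro!: linearI simp: transpose_def vec_eq_iff)
  have "((\<lambda>t. transpose (mexp (- t *\<^sub>R A)) *v x) has_vector_derivative
      A *v (transpose (mexp (- t *\<^sub>R A)) *v x)) (at t)" for x t
  proof -
    have 1: "((\<lambda>t. transpose (mexp (- t *\<^sub>R A))) has_vector_derivative
        transpose (- (mexp (- t *\<^sub>R A) ** A))) (at t)"
      by (rule bounded_linear.has_vector_derivative [OF tr mexp_uminus_has_vector_derivative])
    have 2: "transpose (- (mexp (- t *\<^sub>R A) ** A)) = A ** transpose (mexp (- t *\<^sub>R A))"
      using A by (simp add: linear_neg [OF bounded_linear.linear [OF tr]] matrix_transpose_mul matrix_mult_uminus_left matrix_vector_mult_uminus_left)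
    show ?thesis
      using bounded_bilinear.has_vector_derivative [OF bounded_bilinear_matrix_vector_mult 1 [unfolded 2] has_vector_derivative_const]
      by (simp add: matrix_vector_mul_assoc del: transpose_matrix_vector)
  qed
  from mexp_ode [OF this] have "transpose (mexp (- t *\<^sub>R A)) = mexp (t *\<^sub>R A)"
    by (simp add: matrix_eq del: transpose_matrix_vector)
  then show ?thesis by (metis transpose_transpose)
qed

section \<open>Derivations of the Cayley algebra\<close>

lemma UNIV_8: "(UNIV :: 8 set) = {0, 1, 2, 3, 4, 5, 6, 7}"
proof -
  have "card {0, 1, 2, 3, 4, 5, 6, 7 :: 8} = CARD(8)" by simp
  from card_subset_eq [OF _ _ this] show ?thesis by simp
qed

lemma forall_8: "(\<forall>i::8. P i) \<longleftrightarrow> P 0 \<and> P 1 \<and> P 2 \<and> P 3 \<and> P 4 \<and> P 5 \<and> P 6 \<and> P 7"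
proof -
  have "(\<forall>i::8. P i) \<longleftrightarrow> (\<forall>i\<in>UNIV. P i)" by simp
  then show ?thesis by (simp only: UNIV_8 ball_simps simp_thms)
qed

lemma sum_8: "sum f (UNIV :: 8 set) = f 0 + f 1 + f 2 + f 3 + f 4 + f 5 + f 6 + f 7"
  for f :: "8 \<Rightarrow> 'a::comm_monoid_add"
  unfolding UNIV_8 by (simp add: add.assoc)

lemma distinct_8:
  "(0::8) \<noteq> 1" "(0::8) \<noteq> 2" "(0::8) \<noteq> 3" "(0::8) \<noteq> 4" "(0::8) \<noteq> 5" "(0::8) \<noteq> 6" "(0::8) \<noteq> 7"
  "(1::8) \<noteq> 0" "(1::8) \<noteq> 2" "(1::8) \<noteq> 3" "(1::8) \<noteq> 4" "(1::8) \<noteq> 5" "(1::8) \<noteq> 6" "(1::8) \<noteq> 7"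
  "(2::8) \<noteq> 0" "(2::8) \<noteq> 1" "(2::8) \<noteq> 3" "(2::8) \<noteq> 4" "(2::8) \<noteq> 5" "(2::8) \<noteq> 6" "(2::8) \<noteq> 7"
  "(3::8) \<noteq> 0" "(3::8) \<noteq> 1" "(3::8) \<noteq> 2" "(3::8) \<noteq> 4" "(3::8) \<noteq> 5" "(3::8) \<noteq> 6" "(3::8) \<noteq> 7"
  "(4::8) \<noteq> 0" "(4::8) \<noteq> 1" "(4::8) \<noteq> 2" "(4::8) \<noteq> 3" "(4::8) \<noteq> 5" "(4::8) \<noteq> 6" "(4::8) \<noteq> 7"
  "(5::8) \<noteq> 0" "(5::8) \<noteq> 1" "(5::8) \<noteq> 2" "(5::8) \<noteq> 3" "(5::8) \<noteq> 4" "(5::8) \<noteq> 6" "(5::8) \<noteq> 7"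
  "(6::8) \<noteq> 0" "(6::8) \<noteq> 1" "(6::8) \<noteq> 2" "(6::8) \<noteq> 3" "(6::8) \<noteq> 4" "(6::8) \<noteq> 5" "(6::8) \<noteq> 7"
  "(7::8) \<noteq> 0" "(7::8) \<noteq> 1" "(7::8) \<noteq> 2" "(7::8) \<noteq> 3" "(7::8) \<noteq> 4" "(7::8) \<noteq> 5" "(7::8) \<noteq> 6"
  by simp_all

text \<open>Seven triples in six orders give the 42 products of distinct imaginary units; together
  with the 22 unit products and squares of \<open>cayley_coeff_unit\<close> the multiplication table
  is complete.\<close>

lemma cayley_coeff_triple:
  assumes "(i, j, k) \<in> cayley_triples"
  shows "cayley_coeff i j l = (if l = k then 1 else 0)" "cayley_coeff j k l = (if l = i then 1 else 0)"
    "cayley_coeff k i l = (if l = j then 1 else 0)" "cayley_coeff j i l = (if l = k then - 1 else 0)"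
    "cayley_coeff k j l = (if l = i then - 1 else 0)" "cayley_coeff i k l = (if l = j then - 1 else 0)"
  using assms unfolding cayley_coeff_def cayley_cyclic_def cayley_triples_def
  by (simp only: insert_iff empty_iff prod.inject; elim disjE conjE;
      simp only: distinct_8 simp_thms if_True if_False)+

lemma cayley_coeff_unit:
  "cayley_coeff 0 j l = (if l = j then 1 else 0)" "cayley_coeff j 0 l = (if l = j then 1 else 0)"
  "j \<noteq> 0 \<Longrightarrow> cayley_coeff j j l = (if l = 0 then - 1 else 0)"
  by (simp_all add: cayley_coeff_def)

lemmas cayley_coeff_table = cayley_coeff_unit
  cayley_coeff_triple [of 1 2 3, simplified cayley_triples_def, simplified]
  cayley_coeff_triple [of 1 4 5, simplified cayley_triples_def, simplified]
  cayley_coeff_triple [of 1 6 7, simplified cayley_triples_def, simplified]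
  cayley_coeff_triple [of 2 5 7, simplified cayley_triples_def, simplified]
  cayley_coeff_triple [of 2 6 4, simplified cayley_triples_def, simplified]
  cayley_coeff_triple [of 3 5 6, simplified cayley_triples_def, simplified]
  cayley_coeff_triple [of 3 4 7, simplified cayley_triples_def, simplified]

lemma cayley_mult_nth:
  fixes x y :: "'a::comm_ring_1^8"
  shows
  "cayley_mult x y $ 0 = x $ 0 * y $ 0 - x $ 1 * y $ 1 - x $ 2 * y $ 2 - x $ 3 * y $ 3 - x $ 4 * y $ 4 - x $ 5 * y $ 5 - x $ 6 * y $ 6 - x $ 7 * y $ 7"
  "cayley_mult x y $ 1 = x $ 0 * y $ 1 + x $ 1 * y $ 0 + x $ 2 * y $ 3 - x $ 3 * y $ 2 + x $ 4 * y $ 5 - x $ 5 * y $ 4 + x $ 6 * y $ 7 - x $ 7 * y $ 6"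
  "cayley_mult x y $ 2 = x $ 0 * y $ 2 - x $ 1 * y $ 3 + x $ 2 * y $ 0 + x $ 3 * y $ 1 - x $ 4 * y $ 6 + x $ 5 * y $ 7 + x $ 6 * y $ 4 - x $ 7 * y $ 5"
  "cayley_mult x y $ 3 = x $ 0 * y $ 3 + x $ 1 * y $ 2 - x $ 2 * y $ 1 + x $ 3 * y $ 0 + x $ 4 * y $ 7 + x $ 5 * y $ 6 - x $ 6 * y $ 5 - x $ 7 * y $ 4"
  "cayley_mult x y $ 4 = x $ 0 * y $ 4 - x $ 1 * y $ 5 + x $ 2 * y $ 6 - x $ 3 * y $ 7 + x $ 4 * y $ 0 + x $ 5 * y $ 1 - x $ 6 * y $ 2 + x $ 7 * y $ 3"
  "cayley_mult x y $ 5 = x $ 0 * y $ 5 + x $ 1 * y $ 4 - x $ 2 * y $ 7 - x $ 3 * y $ 6 - x $ 4 * y $ 1 + x $ 5 * y $ 0 + x $ 6 * y $ 3 + x $ 7 * y $ 2"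
  "cayley_mult x y $ 6 = x $ 0 * y $ 6 - x $ 1 * y $ 7 - x $ 2 * y $ 4 + x $ 3 * y $ 5 + x $ 4 * y $ 2 - x $ 5 * y $ 3 + x $ 6 * y $ 0 + x $ 7 * y $ 1"
  "cayley_mult x y $ 7 = x $ 0 * y $ 7 + x $ 1 * y $ 6 + x $ 2 * y $ 5 + x $ 3 * y $ 4 - x $ 4 * y $ 3 - x $ 5 * y $ 2 - x $ 6 * y $ 1 + x $ 7 * y $ 0"
  by (simp_all add: cayley_mult_def sum_8 cayley_coeff_table)

lemma
  fixes x y z :: "'a::comm_ring_1^8"
  shows cayley_mult_add_left: "cayley_mult (x + y) z = cayley_mult x z + cayley_mult y z"
    and cayley_mult_add_right: "cayley_mult x (y + z) = cayley_mult x y + cayley_mult x z"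
    and cayley_mult_scale_left: "cayley_mult (c *s x) y = c *s cayley_mult x y"
    and cayley_mult_scale_right: "cayley_mult x (c *s y) = c *s cayley_mult x y"
  unfolding cayley_mult_def vec_eq_iff vec_lambda_beta vector_add_component
    vector_smult_component distrib_left distrib_right sum.distrib sum_distrib_left
  by (simp_all only: mult.left_commute mult.assoc simp_thms)

lemma bounded_bilinear_cayley_mult:
  "bounded_bilinear (cayley_mult :: complex^8 \<Rightarrow> complex^8 \<Rightarrow> complex^8)"
proof -
  have "r *\<^sub>R x = complex_of_real r *s x" for r and x :: "complex^8"
    unfolding vec_eq_iff vector_scaleR_component vector_smult_component
    by (simp add: scaleR_conv_of_real [where 'a = complex])
  then show ?thesis
    unfolding bilinear_conv_bounded_bilinear [symmetric] bilinear_def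
    by (auto intro!: linearI simp: cayley_mult_add_left cayley_mult_add_right
        cayley_mult_scale_left cayley_mult_scale_right)
qed

lemma mscale_vec_mult: "mscale c A *v x = c *s (A *v x)"
  unfolding mscale_def matrix_vector_mult_def vec_eq_iff vec_lambda_beta vector_smult_component
    sum_distrib_left
  by (simp only: mult.assoc simp_thms)

text \<open>The linearisation of the equations of \<open>G2C\<close> at the identity. Being given by
  linear conditions, it is visibly a complex subspace; \<open>lie_algebra_G2C\<close> identifies it
  with the Lie algebra.\<close>

definition G2_der :: "(complex^8^8) set" where
  "G2_der = {X. transpose X = - X \<and>
     (\<forall>x y. X *v cayley_mult x y = cayley_mult (X *v x) y + cayley_mult x (X *v y))}"

lemma G2_der_subspace: "cmat.subspace G2_der"
proof (rule cmat.subspaceI)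
  have "transpose (0 :: complex^8^8) = - 0"
    by (simp add: vec_eq_iff transpose_def)
  moreover have "cayley_mult 0 x = 0" "cayley_mult x 0 = 0" for x :: "complex^8"
    using cayley_mult_scale_left [of 0 0 x] cayley_mult_scale_right [of x 0 0] by simp_all
  ultimately show "0 \<in> G2_der"
    by (simp add: G2_der_def)
next
  fix X Y assume *: "X \<in> G2_der" "Y \<in> G2_der"
  have "transpose (X + Y) = transpose X + transpose Y"
    by (simp add: vec_eq_iff transpose_def)
  with * show "X + Y \<in> G2_der"
    by (simp add: G2_der_def matrix_vector_mult_add_rdistrib cayley_mult_add_left
        cayley_mult_add_right)
next
  fix c X assume *: "X \<in> G2_der"
  have "transpose (mscale c X) = mscale c (transpose X)"
    by (simp add: vec_eq_iff transpose_def mscale_def)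
  with * show "mscale c X \<in> G2_der"
    by (simp add: G2_der_def mscale_vec_mult cayley_mult_scale_left cayley_mult_scale_right
        vector_add_ldistrib)
qed

definition skew :: "8 \<Rightarrow> 8 \<Rightarrow> complex^8^8" where
  "skew a b = (\<chi> i j. (if i = a \<and> j = b then 1 else 0) - (if i = b \<and> j = a then 1 else 0))"

lemma skew_vec_mult: "(skew a b *v x) $ i = (if i = a then x $ b else 0) - (if i = b then x $ a else 0)"
proof -
  have "(skew a b *v x) $ i = (\<Sum>j\<in>UNIV. (if j = b then if i = a then x $ j else 0 else 0)
      - (if j = a then if i = b then x $ j else 0 else 0))"
    unfolding skew_def matrix_vector_mult_def by (auto intro!: sum.cong)
  then show ?thesis by (simp add: sum_subtractf)
qed

lemma skew_diff_mult_nth: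
  "((skew a b - skew c d) *v x) $ i = (if i = a then x $ b else 0) - (if i = b then x $ a else 0)
     - (if i = c then x $ d else 0) + (if i = d then x $ c else 0)"
  by (simp add: matrix_vector_mult_diff_rdistrib skew_vec_mult)

lemma transpose_skew: "transpose (skew a b) = - skew a b"
  unfolding transpose_def skew_def vec_eq_iff by (simp add: conj_commute)

lemma skew_diff_G2_derI:
  assumes "\<And>x y. \<forall>k. ((skew a b - skew c d) *v cayley_mult x y) $ k
      = cayley_mult ((skew a b - skew c d) *v x) y $ k + cayley_mult x ((skew a b - skew c d) *v y) $ k"
  shows "skew a b - skew c d \<in> G2_der"
proof -
  have "transpose (skew a b - skew c d) = transpose (skew a b) - transpose (skew c d)"
    by (simp add: transpose_def vec_eq_iff)
  then have "transpose (skew a b - skew c d) = - (skew a b - skew c d)"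
    by (simp add: transpose_skew)
  moreover have "(skew a b - skew c d) *v cayley_mult x y
      = cayley_mult ((skew a b - skew c d) *v x) y + cayley_mult x ((skew a b - skew c d) *v y)" for x y
    unfolding vec_eq_iff vector_add_component by (rule assms)
  ultimately show ?thesis by (simp add: G2_der_def)
qed

text \<open>The first nine form three triples, each a copy of the imaginary quaternions: they vanish
  on the quaternion subalgebras with imaginary units e_1, e_2, e_3, then e_1, e_6, e_7, then e_3,
  e_4, e_7. The last one combines with the seventh to give \<open>tau\<close>.\<close>

lemma skew_diff_G2_der:
  "skew 5 4 - skew 7 6 \<in> G2_der"
  "skew 6 4 - skew 5 7 \<in> G2_der"
  "skew 7 4 - skew 6 5 \<in> G2_der"
  "skew 3 2 - skew 5 4 \<in> G2_der"
  "skew 4 2 - skew 3 5 \<in> G2_der"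
  "skew 5 2 - skew 4 3 \<in> G2_der"
  "skew 2 1 - skew 6 5 \<in> G2_der"
  "skew 5 1 - skew 2 6 \<in> G2_der"
  "skew 6 1 - skew 5 2 \<in> G2_der"
  "skew 2 1 - skew 7 4 \<in> G2_der"
  by (rule skew_diff_G2_derI; unfold forall_8;
      intro conjI; simp only: cayley_mult_nth skew_diff_mult_nth distinct_8 if_True if_False simp_thms
        diff_zero diff_0 add_0 add_0_right; algebra)+

text \<open>Both derivations send e_1 to e_2, and their difference kills e_1, so it lies in the
  subalgebra. The equal weights 1/2 remove that component.\<close>

lemma tau_eq: "tau t = mscale (of_real t * \<i> / 2) ((skew 2 1 - skew 7 4) + (skew 2 1 - skew 6 5))"
  unfolding vec_eq_iff forall_8 tau_def diag2_def delta_def mscale_def skew_def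
  by (simp add: distinct_8)

section \<open>The Lie algebra of the automorphism group\<close>

lemma mexp_orthogonal:
  assumes "transpose X = - X"
  shows "transpose (mexp (t *\<^sub>R X)) ** mexp (t *\<^sub>R X) = mat 1"
  by (simp only: transpose_mexp [OF assms] mexp_inverse)

text \<open>Orthogonality alone leaves the sign of the determinant open. The exponential is the
  square of the one at half time, and the square of a determinant 1 or -1 is 1.\<close>

lemma det_mexp_skew:
  fixes X :: "complex^'n^'n"
  assumes "transpose X = - X"
  shows "det (mexp (t *\<^sub>R X)) = 1"
proof -
  let ?h = "mexp ((t / 2) *\<^sub>R X)"
  have "det (transpose ?h ** ?h) = det (mat 1 :: complex^'n^'n)"
    by (simp only: mexp_orthogonal [OF assms])
  moreover have "mexp (t *\<^sub>R X) = ?h ** ?h"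
    by (simp add: mexp_add [symmetric])
  ultimately show ?thesis
    by (simp add: det_mul)
qed

text \<open>By the Leibniz rule the product of the two moving vectors solves the flow equation of X,
  with initial value the product of x and y.\<close>

lemma mexp_derivation:
  fixes X :: "complex^8^8"
  assumes X: "\<And>x y. X *v cayley_mult x y = cayley_mult (X *v x) y + cayley_mult x (X *v y)"
  shows "cayley_mult (mexp (t *\<^sub>R X) *v x) (mexp (t *\<^sub>R X) *v y) = mexp (t *\<^sub>R X) *v cayley_mult x y"
proof -
  have "((\<lambda>t. cayley_mult (mexp (t *\<^sub>R X) *v x) (mexp (t *\<^sub>R X) *v y)) has_vector_derivative
      X *v cayley_mult (mexp (t *\<^sub>R X) *v x) (mexp (t *\<^sub>R X) *v y)) (at t)" for t
    using bounded_bilinear.has_vector_derivative [OF bounded_bilinear_cayley_mult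
        mexp_vector_has_vector_derivative mexp_vector_has_vector_derivative]
    unfolding X by (simp add: add.commute)
  from mexp_ode [OF this] show ?thesis by simp
qed

lemma G2_der_mexp: "X \<in> G2_der \<Longrightarrow> mexp (t *\<^sub>R X) \<in> G2C"
  by (simp add: G2_der_def G2C_def SO8C_def det_mexp_skew mexp_orthogonal mexp_derivation)

lemma mexp_has_vector_derivative_0: "((\<lambda>t. mexp (t *\<^sub>R X)) has_vector_derivative X) (at 0)"
  using mexp_has_vector_derivative [of X 0] by simp

lemma mexp_vector_has_vector_derivative_0: "((\<lambda>t. mexp (t *\<^sub>R X) *v x) has_vector_derivative X *v x) (at 0)"
  using mexp_vector_has_vector_derivative [of X x 0] by simp

text \<open>One inclusion integrates a skew derivation to automorphisms; the other differentiates
  the orthogonality and multiplicativity of exp(tX) at t = 0.\<close>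

theorem lie_algebra_G2C: "lie_algebra G2C = G2_der"
proof
  show "G2_der \<subseteq> lie_algebra G2C"
    by (auto simp: lie_algebra_def G2_der_mexp)
  show "lie_algebra G2C \<subseteq> G2_der"
  proof
    fix X assume "X \<in> lie_algebra G2C"
    then have *: "transpose (mexp (t *\<^sub>R X)) ** mexp (t *\<^sub>R X) = mat 1"
      "cayley_mult (mexp (t *\<^sub>R X) *v x) (mexp (t *\<^sub>R X) *v y) = mexp (t *\<^sub>R X) *v cayley_mult x y" for t x y
      by (auto simp: lie_algebra_def G2C_def SO8C_def)
    have tr: "bounded_linear (transpose :: complex^8^8 \<Rightarrow> complex^8^8)"
      unfolding linear_conv_bounded_linear [symmetric]
      by (auto intro!: linearI simp: transpose_def vec_eq_iff)
    have "((\<lambda>t. transpose (mexp (t *\<^sub>R X)) ** mexp (t *\<^sub>R X)) has_vector_derivative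
        transpose (mexp (0 *\<^sub>R X)) ** X + transpose X ** mexp (0 *\<^sub>R X)) (at 0)"
      by (intro bounded_bilinear.has_vector_derivative [OF bounded_bilinear_matrix_mult]
          bounded_linear.has_vector_derivative [OF tr] mexp_has_vector_derivative_0)
    then have "((\<lambda>t::real. mat 1 :: complex^8^8) has_vector_derivative X + transpose X) (at 0)"
      by (simp add: *)
    from vector_derivative_unique_at [OF this has_vector_derivative_const]
    have "transpose X = - X"
      by (simp add: eq_neg_iff_add_eq_0 add.commute)
    moreover have "X *v cayley_mult x y = cayley_mult (X *v x) y + cayley_mult x (X *v y)" for x y
    proof -
      have "((\<lambda>t. cayley_mult (mexp (t *\<^sub>R X) *v x) (mexp (t *\<^sub>R X) *v y)) has_vector_derivative
          cayley_mult (mexp (0 *\<^sub>R X) *v x) (X *v y) + cayley_mult (X *v x) (mexp (0 *\<^sub>R X) *v y)) (at 0)"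
        by (intro bounded_bilinear.has_vector_derivative [OF bounded_bilinear_cayley_mult]
            mexp_vector_has_vector_derivative_0)
      then have "((\<lambda>t. mexp (t *\<^sub>R X) *v cayley_mult x y) has_vector_derivative
          cayley_mult x (X *v y) + cayley_mult (X *v x) y) (at 0)"
        by (simp add: *)
      from vector_derivative_unique_at [OF this mexp_vector_has_vector_derivative_0]
      show ?thesis by (simp add: add.commute)
    qed
    ultimately show "X \<in> G2_der"
      by (simp add: G2_der_def)
  qed
qed

lemma lie_algebra_SL3C:
  assumes "Y \<in> lie_algebra SL3C"
  shows "Y \<in> G2_der" "Y *v axis 1 1 = 0"
proof -
  from assms have *: "mexp (t *\<^sub>R Y) \<in> G2C" "mexp (t *\<^sub>R Y) *v axis 1 1 = axis 1 1" for t
    by (auto simp: lie_algebra_def SL3C_def)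
  then show "Y \<in> G2_der"
    by (simp add: lie_algebra_G2C [symmetric] lie_algebra_def)
  have "((\<lambda>t::real. axis 1 1) has_vector_derivative Y *v axis 1 1) (at 0)"
    using mexp_vector_has_vector_derivative_0 [of Y "axis 1 1"] by (simp add: *)
  from vector_derivative_unique_at [OF this has_vector_derivative_const]
  show "Y *v axis 1 1 = 0" .
qed

section \<open>Real points, and closure of the groups under products and inverses\<close>

lemma mpow_real:
  assumes "\<And>i j. A $ i $ j \<in> \<real>"
  shows "mpow A k $ i $ j \<in> \<real>"
proof (induction k arbitrary: i j)
  case 0
  then show ?case by (simp add: mat_def)
next
  case (Suc k)
  then show ?case by (simp add: mpow_Suc matrix_matrix_mult_def assms sum_in_Reals)
qed

lemma mexp_real:
  assumes "\<And>i j. A $ i $ j \<in> \<real>"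
  shows "mexp (t *\<^sub>R A) $ i $ j \<in> \<real>"
proof -
  have "mpow A k $ i $ j / fact k * of_real t ^ k \<in> \<real>" for k
  proof -
    have "(fact k :: complex) \<in> \<real>" by (metis Reals_of_nat of_nat_fact)
    with mpow_real [OF assms] show ?thesis by (intro Reals_mult Reals_divide Reals_power) auto
  qed
  then have "Im (mpow A k $ i $ j / fact k * of_real t ^ k) = 0" for k
    unfolding complex_is_Real_iff .
  then have "Im (mexp (t *\<^sub>R A) $ i $ j) = 0"
    unfolding scaleR_eq_mscale mexp_nth
    by (subst bounded_linear.suminf [OF bounded_linear_Im summable_mexp]) simp
  then show ?thesis by (simp add: complex_is_Real_iff)
qed

text \<open>Multiplicativity on real vectors extends to complex ones by bilinearity, after splitting
  both factors into real and imaginary parts.\<close>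

lemma G2_eq: "G2 = {g \<in> G2C. \<forall>i j. g $ i $ j \<in> \<real>}"
proof -
  have "cayley_mult (g *v x) (g *v y) = g *v cayley_mult x y"
    if g: "\<forall>x\<in>cayley_real. \<forall>y\<in>cayley_real. cayley_mult (g *v x) (g *v y) = g *v cayley_mult x y"
    for g :: "complex^8^8" and x y
  proof -
    define re im where "re x = (\<chi> i. complex_of_real (Re (x $ i)))"
      and "im x = (\<chi> i. complex_of_real (Im (x $ i)))" for x :: "complex^8"
    have split: "x = re x + \<i> *s im x" for x
      by (simp add: re_def im_def vec_eq_iff complex_eq_iff)
    have "re x \<in> cayley_real" "im x \<in> cayley_real" for x
      by (simp_all add: re_def im_def cayley_real_def)
    then have *: "cayley_mult (g *v re x) (g *v re y) = g *v cayley_mult (re x) (re y)"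
      "cayley_mult (g *v im x) (g *v re y) = g *v cayley_mult (im x) (re y)"
      "cayley_mult (g *v re x) (g *v im y) = g *v cayley_mult (re x) (im y)"
      "cayley_mult (g *v im x) (g *v im y) = g *v cayley_mult (im x) (im y)" for x y
      using g by auto
    have "cayley_mult (g *v (re x + \<i> *s im x)) (g *v (re y + \<i> *s im y))
        = g *v cayley_mult (re x + \<i> *s im x) (re y + \<i> *s im y)"
      by (simp add: matrix_vector_right_distrib matrix_vector_mult_diff_distrib vector_scalar_commute
          cayley_mult_add_left
          cayley_mult_add_right cayley_mult_scale_left cayley_mult_scale_right *)
    then show ?thesis
      by (simp only: split [symmetric])
  qed
  then show ?thesis
    unfolding G2_def G2C_def SO8_def by blast
qed

lemma G2_der_mexp_real:
  assumes "X \<in> G2_der" "\<And>i j. X $ i $ j \<in> \<real>"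
  shows "mexp (t *\<^sub>R X) \<in> G2"
  using assms by (simp add: G2_eq G2_der_mexp mexp_real)

lemma G2C_mult: "g \<in> G2C \<Longrightarrow> h \<in> G2C \<Longrightarrow> g ** h \<in> G2C"
proof -
  assume *: "g \<in> G2C" "h \<in> G2C"
  have "transpose (g ** h) ** (g ** h) = transpose h ** ((transpose g ** g) ** h)"
    by (simp add: matrix_transpose_mul matrix_mul_assoc)
  with * show ?thesis
    by (simp add: G2C_def SO8C_def det_mul matrix_vector_mul_assoc [symmetric])
qed

lemma G2C_transpose_mult:
  assumes "g \<in> G2C"
  shows "transpose g ** g = mat 1" "g ** transpose g = mat 1"
  using assms by (auto simp: G2C_def SO8C_def matrix_left_right_inverse)

lemma cayley_mult_transpose:
  assumes "transpose g ** g = mat 1" "g ** transpose g = mat 1"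
    and g: "\<And>x y. cayley_mult (g *v x) (g *v y) = g *v cayley_mult x y"
  shows "cayley_mult (transpose g *v x) (transpose g *v y) = transpose g *v cayley_mult x y"
proof -
  have "cayley_mult (transpose g *v x) (transpose g *v y)
      = transpose g *v (g *v cayley_mult (transpose g *v x) (transpose g *v y))"
    by (simp only: matrix_vector_mul_assoc assms matrix_vector_mul_lid)
  also have "\<dots> = transpose g *v cayley_mult (g *v (transpose g *v x)) (g *v (transpose g *v y))"
    by (simp only: g)
  finally show ?thesis
    by (simp only: matrix_vector_mul_assoc assms matrix_vector_mul_lid)
qed

lemma G2C_transpose:
  assumes g: "g \<in> G2C"
  shows "transpose g \<in> G2C"
proof -
  have "cayley_mult (transpose g *v x) (transpose g *v y) = transpose g *v cayley_mult x y" for x y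
    using g by (intro cayley_mult_transpose G2C_transpose_mult) (auto simp: G2C_def)
  with g show ?thesis
    unfolding G2C_def SO8C_def by (simp add: G2C_transpose_mult [OF g] del: transpose_matrix_vector)
qed

lemma G2_mult: "g \<in> G2 \<Longrightarrow> h \<in> G2 \<Longrightarrow> g ** h \<in> G2"
  by (auto simp: G2_eq G2C_mult) (simp add: matrix_matrix_mult_def)

lemma G2_transpose: "g \<in> G2 \<Longrightarrow> transpose g \<in> G2"
  by (auto simp: G2_eq G2C_transpose) (simp add: transpose_def)

lemma G2C_one: "mat 1 \<in> G2C"
  by (simp add: G2C_def SO8C_def)

lemma G2_one: "mat 1 \<in> G2"
  by (simp add: G2_eq G2C_one) (simp add: mat_def)

section \<open>The Killing form\<close>

text \<open>The choice made inside \<open>trace_on\<close> depends on V alone, so one basis serves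
  all endomorphisms f at once and different traces can be compared term by term.\<close>

lemma trace_on_basis:
  assumes "cmat.subspace V"
  obtains B where "cmat.independent B" "cmat.span B = V"
    "\<And>f. trace_on V f = (\<Sum>b\<in>B. cmat.representation B (f b) b)"
proof -
  obtain B where "B \<subseteq> V" "cmat.independent B" "V \<subseteq> cmat.span B"
    by (rule cmat.basis_exists [of V]) blast
  with assms have "\<exists>B. cmat.independent B \<and> cmat.span B = V"
    by (metis cmat.span_minimal subset_antisym)
  from someI_ex [OF this] show thesis
    by (intro that) (auto simp: trace_on_def Let_def)
qed

lemma trace_on_add:
  assumes "cmat.subspace V" "\<And>v. v \<in> V \<Longrightarrow> f v \<in> V" "\<And>v. v \<in> V \<Longrightarrow> g v \<in> V"
  shows "trace_on V (\<lambda>v. f v + g v) = trace_on V f + trace_on V g"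
proof -
  obtain B where B: "cmat.independent B" "cmat.span B = V"
    "\<And>f. trace_on V f = (\<Sum>b\<in>B. cmat.representation B (f b) b)"
    using trace_on_basis [OF assms(1)] by blast
  have "cmat.representation B (f b + g b) b = cmat.representation B (f b) b + cmat.representation B (g b) b"
    if "b \<in> B" for b
    using that assms B(1,2) cmat.span_base [OF that] by (subst cmat.representation_add) auto
  then show ?thesis
    by (simp add: B(3) sum.distrib)
qed

lemma trace_on_commute:
  assumes V: "cmat.subspace V" and f: "\<And>v. v \<in> V \<Longrightarrow> f v \<in> V" and g: "\<And>v. v \<in> V \<Longrightarrow> g v \<in> V"
    and lf: "Vector_Spaces.linear mscale mscale f" and lg: "Vector_Spaces.linear mscale mscale g"
  shows "trace_on V (\<lambda>v. f (g v)) = trace_on V (\<lambda>v. g (f v))"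
proof -
  obtain B where B: "cmat.independent B" "cmat.span B = V"
    "\<And>f. trace_on V f = (\<Sum>b\<in>B. cmat.representation B (f b) b)"
    using trace_on_basis [OF V] by blast
  have BV: "b \<in> V" if "b \<in> B" for b
    using cmat.span_base [OF that] B(2) by simp
  show ?thesis
  proof (cases "finite B")
    case True
    have expand: "cmat.representation B (p (q b)) b
        = (\<Sum>c\<in>B. cmat.representation B (q b) c * cmat.representation B (p c) b)"
      if p: "\<And>v. v \<in> V \<Longrightarrow> p v \<in> V" and q: "\<And>v. v \<in> V \<Longrightarrow> q v \<in> V"
        and lp: "Vector_Spaces.linear mscale mscale p" and b: "b \<in> B" for p q b
    proof -
      have hom: "module_hom mscale mscale p"
        using lp by (simp add: Vector_Spaces.linear_def)
      have "q b = (\<Sum>c\<in>B. mscale (cmat.representation B (q b) c) c)"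
        using B(1,2) q [OF BV [OF b]] True by (simp add: cmat.sum_representation_eq)
      then have "p (q b) = p (\<Sum>c\<in>B. mscale (cmat.representation B (q b) c) c)"
        by simp
      also have "\<dots> = (\<Sum>c\<in>B. mscale (cmat.representation B (q b) c) (p c))"
        by (simp only: module_hom.sum [OF hom] module_hom.scale [OF hom])
      finally have *: "p (q b) = \<dots>" .
      have "cmat.representation B (\<Sum>c\<in>B. mscale (cmat.representation B (q b) c) (p c)) b
          = (\<Sum>c\<in>B. cmat.representation B (mscale (cmat.representation B (q b) c) (p c)) b)"
        using B(1,2) p BV cmat.subspace_scale [OF V] by (subst cmat.representation_sum) auto
      then show ?thesis
        unfolding * using B(1,2) p BV by (simp add: cmat.representation_scale)
    qed
    have "trace_on V (\<lambda>v. f (g v))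
        = (\<Sum>b\<in>B. \<Sum>c\<in>B. cmat.representation B (g b) c * cmat.representation B (f c) b)"
      unfolding B(3) by (intro sum.cong refl expand f g lf)
    also have "\<dots> = (\<Sum>b\<in>B. \<Sum>c\<in>B. cmat.representation B (f b) c * cmat.representation B (g c) b)"
      by (subst sum.swap) (simp only: mult.commute)
    also have "\<dots> = trace_on V (\<lambda>v. g (f v))"
      unfolding B(3) by (intro sum.cong refl expand [symmetric] f g lg)
    finally show ?thesis .
  \<comment> \<open>Over an infinite index set both sums are 0 by convention.\<close>
  qed (simp add: B(3))
qed

lemma mscale_mult_left: "mscale c A ** B = mscale c (A ** B)" for B :: "complex^'k^'m"
  and A :: "complex^'m^'n"
  unfolding mscale_def matrix_matrix_mult_def vec_eq_iff vec_lambda_beta sum_distrib_left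
  by (simp only: mult.assoc simp_thms)

lemma mscale_mult_right: "A ** mscale c B = mscale c (A ** B)" for B :: "complex^'k^'m"
  and A :: "complex^'m^'n"
  unfolding mscale_def matrix_matrix_mult_def vec_eq_iff vec_lambda_beta sum_distrib_left
  by (simp only: mult.left_commute simp_thms)

lemma
  fixes A :: "complex^'m^'n" and B :: "complex^'k^'m"
  shows matrix_add_rdistrib: "(A + A') ** B = A ** B + A' ** B"
    and matrix_mult_diff_left: "(A - A') ** B = A ** B - A' ** B"
    and matrix_mult_diff_right: "A ** (B - B') = A ** B - A ** B'"
  by (simp_all add: bounded_bilinear.add_left [OF bounded_bilinear_matrix_mult]
      bounded_bilinear.diff_left [OF bounded_bilinear_matrix_mult]
      bounded_bilinear.diff_right [OF bounded_bilinear_matrix_mult])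

lemma linear_conjugation: "Vector_Spaces.linear mscale mscale (\<lambda>W. A ** W ** B)"
  for A B :: "complex^'n^'n"
  by unfold_locales
    (simp_all add: matrix_add_ldistrib matrix_add_rdistrib mscale_mult_left mscale_mult_right)

lemma linear_bracket: "Vector_Spaces.linear mscale mscale (bracket X)"
  unfolding bracket_def
  by unfold_locales
    (simp_all add: matrix_add_ldistrib matrix_add_rdistrib mscale_mult_left mscale_mult_right
      cmat.scale_right_diff_distrib)

lemma linear_compose:
  assumes "Vector_Spaces.linear mscale mscale f" "Vector_Spaces.linear mscale mscale g"
  shows "Vector_Spaces.linear mscale mscale (\<lambda>W. f (g W))"
  using Vector_Spaces.linear_compose [OF assms(2,1)] by (simp add: o_def)

lemma bracket_G2_der:
  assumes "X \<in> G2_der" "Y \<in> G2_der"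
  shows "bracket X Y \<in> G2_der"
proof -
  have "transpose (bracket X Y) = transpose (X ** Y) - transpose (Y ** X)"
    by (simp add: bracket_def transpose_def vec_eq_iff)
  with assms have "transpose (bracket X Y) = - bracket X Y"
    by (simp add: G2_der_def matrix_transpose_mul bracket_def matrix_mult_uminus_left matrix_mult_uminus_right)
  with assms show ?thesis
    by (simp add: G2_der_def bracket_def matrix_vector_mult_diff_rdistrib
        matrix_vector_mul_assoc [symmetric] matrix_vector_right_distrib
        bounded_bilinear.diff_left [OF bounded_bilinear_cayley_mult]
        bounded_bilinear.diff_right [OF bounded_bilinear_cayley_mult])
qed

lemma conjugation_bracket:
  assumes "transpose Z ** Z = mat 1"
  shows "Z ** bracket X Y ** transpose Z = bracket (Z ** X ** transpose Z) (Z ** Y ** transpose Z)"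
proof -
  have "(Z ** X ** transpose Z) ** (Z ** Y ** transpose Z) = Z ** X ** (transpose Z ** Z) ** Y ** transpose Z" for X Y
    by (simp only: matrix_mul_assoc)
  then show ?thesis
    by (simp add: bracket_def assms matrix_mult_diff_left matrix_mult_diff_right matrix_mul_assoc)
qed

text \<open>Write C for conjugation by Z. Since C respects brackets, ad(CX) ad(CY) = C ad(X) ad(Y)
  C^-1, and \<open>trace_on_commute\<close> carries C to the other end, where it cancels.\<close>

lemma killing_form_conjugation:
  assumes L: "cmat.subspace L" "\<And>X Y. X \<in> L \<Longrightarrow> Y \<in> L \<Longrightarrow> bracket X Y \<in> L"
    and Z: "transpose Z ** Z = mat 1" "Z ** transpose Z = mat 1"
    and ZL: "\<And>X. X \<in> L \<Longrightarrow> Z ** X ** transpose Z \<in> L" "\<And>X. X \<in> L \<Longrightarrow> transpose Z ** X ** Z \<in> L"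
    and X: "X \<in> L" and Y: "Y \<in> L"
  shows "killing_form L (Z ** X ** transpose Z) (Z ** Y ** transpose Z) = killing_form L X Y"
proof -
  let ?A = "\<lambda>W. Z ** W ** transpose Z" and ?B = "\<lambda>W. transpose Z ** W ** Z"
  let ?f = "\<lambda>W. bracket X (bracket Y (?B W))"
  have AB: "?A (?B W) = W" and BA: "?B (?A W) = W" for W
  proof -
    have "?A (?B W) = (Z ** transpose Z) ** W ** (Z ** transpose Z)"
      by (simp only: matrix_mul_assoc)
    then show "?A (?B W) = W" by (simp add: Z)
    have "?B (?A W) = (transpose Z ** Z) ** W ** (transpose Z ** Z)"
      by (simp only: matrix_mul_assoc)
    then show "?B (?A W) = W" by (simp add: Z)
  qed
  have "killing_form L (?A X) (?A Y) = trace_on L (\<lambda>W. ?A (?f W))"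
    unfolding killing_form_def by (simp add: conjugation_bracket [OF Z(1)] AB)
  also have "\<dots> = trace_on L (\<lambda>W. ?f (?A W))"
    by (rule trace_on_commute [OF L(1)])
      (auto intro!: L X Y ZL linear_conjugation linear_compose [OF linear_bracket])
  also have "\<dots> = killing_form L X Y"
    by (simp add: killing_form_def BA)
  finally show ?thesis .
qed

text \<open>Z enters through the equations of an orthogonal automorphism rather than as a member of
  \<open>G2C\<close>; thus it applies to \<open>sl3_centre\<close> without an 8 x 8
  determinant.\<close>

lemma conjugation_G2_der:
  assumes ZZ: "transpose Z ** Z = mat 1" "Z ** transpose Z = mat 1"
    and Z: "\<And>x y. cayley_mult (Z *v x) (Z *v y) = Z *v cayley_mult x y"
    and X: "transpose X = - X" "\<And>x y. X *v cayley_mult x y = cayley_mult (X *v x) y + cayley_mult x (X *v y)"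
  shows "Z ** X ** transpose Z \<in> G2_der"
proof -
  have "transpose (Z ** X ** transpose Z) = - (Z ** X ** transpose Z)"
    by (simp only: matrix_transpose_mul transpose_transpose X(1) matrix_mult_uminus_left
        matrix_mult_uminus_right matrix_mul_assoc)
  moreover have "Z ** X ** transpose Z *v cayley_mult x y
      = cayley_mult (Z ** X ** transpose Z *v x) y + cayley_mult x (Z ** X ** transpose Z *v y)" for x y
  proof -
    have inv: "Z *v (transpose Z *v v) = v" for v
      by (simp only: matrix_vector_mul_assoc ZZ matrix_vector_mul_lid)
    have "Z ** X ** transpose Z *v cayley_mult x y = Z *v (X *v (transpose Z *v cayley_mult x y))"
      by (simp only: matrix_vector_mul_assoc matrix_mul_assoc)
    also have "\<dots> = Z *v cayley_mult (X *v (transpose Z *v x)) (transpose Z *v y)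
        + Z *v cayley_mult (transpose Z *v x) (X *v (transpose Z *v y))"
      by (simp only: cayley_mult_transpose [OF ZZ Z, symmetric] X(2) matrix_vector_right_distrib)
    also have "\<dots> = cayley_mult (Z *v (X *v (transpose Z *v x))) y + cayley_mult x (Z *v (X *v (transpose Z *v y)))"
      by (simp only: Z [symmetric] inv)
    finally show ?thesis
      by (simp only: matrix_vector_mul_assoc matrix_mul_assoc)
  qed
  ultimately show ?thesis
    unfolding G2_der_def by blast
qed

text \<open>With \<open>s = \<plusminus> \<surd>3 / 2\<close> these are the generators of the centre of \<open>SL(3, \<complex>)\<close>: they fix
  \<open>e_0\<close> and \<open>e_1\<close>, and act on the complement as \<open>- 1/2 + s L\<close>, where \<open>L\<close> is left
  multiplication by \<open>e_1\<close>.\<close>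

definition sl3_centre :: "complex \<Rightarrow> complex^8^8" where
  "sl3_centre s = (\<chi> i j. if i = j then if i = 0 \<or> i = 1 then 1 else - 1 / 2 else 0)
     + mscale s (skew 3 2 + skew 5 4 + skew 7 6)"

lemma sl3_centre_nth:
  "(sl3_centre s *v x) $ 0 = x $ 0"
  "(sl3_centre s *v x) $ 1 = x $ 1"
  "(sl3_centre s *v x) $ 2 = - x $ 2 / 2 - s * x $ 3"
  "(sl3_centre s *v x) $ 3 = - x $ 3 / 2 + s * x $ 2"
  "(sl3_centre s *v x) $ 4 = - x $ 4 / 2 - s * x $ 5"
  "(sl3_centre s *v x) $ 5 = - x $ 5 / 2 + s * x $ 4"
  "(sl3_centre s *v x) $ 6 = - x $ 6 / 2 - s * x $ 7"
  "(sl3_centre s *v x) $ 7 = - x $ 7 / 2 + s * x $ 6"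
proof -
  have "((\<chi> i j. if i = j then d i else 0) *v x) $ i = d i * x $ i" for d :: "8 \<Rightarrow> complex" and i
  proof -
    have "((\<chi> i j. if i = j then d i else 0) *v x) $ i = (\<Sum>j\<in>UNIV. if i = j then d i * x $ j else 0)"
      unfolding matrix_vector_mult_def vec_lambda_beta by (intro sum.cong) auto
    then show ?thesis by simp
  qed
  then have "(sl3_centre s *v x) $ i = (if i = 0 \<or> i = 1 then 1 else - 1 / 2) * x $ i
     + s * ((skew 3 2 *v x) $ i + (skew 5 4 *v x) $ i + (skew 7 6 *v x) $ i)" for i
    by (simp add: sl3_centre_def matrix_vector_mult_add_rdistrib mscale_vec_mult distrib_left)
  then show
  "(sl3_centre s *v x) $ 0 = x $ 0"
  "(sl3_centre s *v x) $ 1 = x $ 1"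
  "(sl3_centre s *v x) $ 2 = - x $ 2 / 2 - s * x $ 3"
  "(sl3_centre s *v x) $ 3 = - x $ 3 / 2 + s * x $ 2"
  "(sl3_centre s *v x) $ 4 = - x $ 4 / 2 - s * x $ 5"
  "(sl3_centre s *v x) $ 5 = - x $ 5 / 2 + s * x $ 4"
  "(sl3_centre s *v x) $ 6 = - x $ 6 / 2 - s * x $ 7"
  "(sl3_centre s *v x) $ 7 = - x $ 7 / 2 + s * x $ 6"
    by (simp_all add: skew_vec_mult)
qed

lemma transpose_sl3_centre: "transpose (sl3_centre s) = sl3_centre (- s)"
proof -
  have "transpose (sl3_centre s) = (\<chi> i j. if i = j then if i = 0 \<or> i = 1 then 1 else - 1 / 2 else 0)
     + mscale s (transpose (skew 3 2) + transpose (skew 5 4) + transpose (skew 7 6))"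
    unfolding sl3_centre_def transpose_def vec_eq_iff mscale_def by simp
  then show ?thesis
    unfolding transpose_skew sl3_centre_def by (simp add: algebra_simps)
qed

text \<open>On the complement L squares to -1, so (- 1/2 - s L)(- 1/2 + s L) = 1/4 + s^2; this fixes
  the value 3/4.\<close>

lemma sl3_centre_orthogonal:
  assumes "s * s = 3 / 4"
  shows "sl3_centre (- s) ** sl3_centre s = mat 1"
proof -
  have ss: "s * s = 3 / 4" "s * (s * z) = 3 / 4 * z" for z
    using assms by (simp_all only: mult.assoc [symmetric])
  have "\<forall>k. (sl3_centre (- s) *v (sl3_centre s *v x)) $ k = x $ k" for x
    unfolding forall_8 sl3_centre_nth
    by (intro conjI; simp add: algebra_simps add_divide_distrib diff_divide_distrib ss)
  then show ?thesis
    by (simp add: matrix_eq matrix_vector_mul_assoc [symmetric] vec_eq_iff)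
qed

text \<open>The complement of span(e_0, e_1) is a C^3 with complex structure L, on which the map is
  multiplication by a cube root of unity omega. The part of the product in span(e_0, e_1) is
  sesquilinear and keeps its value as |omega| = 1; the part in C^3 is conjugate-linear in both
  factors and picks up the square of conj omega, which is omega. The proof checks this in
  coordinates.\<close>

lemma sl3_centre_automorphism:
  assumes "s * s = 3 / 4"
  shows "cayley_mult (sl3_centre s *v x) (sl3_centre s *v y) = sl3_centre s *v cayley_mult x y"
proof -
  have ss: "s * s = 3 / 4" "s * (s * z) = 3 / 4 * z" for z
    using assms by (simp_all only: mult.assoc [symmetric])
  have "\<forall>k. cayley_mult (sl3_centre s *v x) (sl3_centre s *v y) $ k = (sl3_centre s *v cayley_mult x y) $ k"
    unfolding forall_8 cayley_mult_nth sl3_centre_nth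
    by (intro conjI; simp add: algebra_simps add_divide_distrib diff_divide_distrib ss)
  then show ?thesis by (simp add: vec_eq_iff)
qed

lemma axis_nth: "(axis i 1 :: complex^8) $ j = (if j = i then 1 else 0)"
  by (simp add: axis_def)

lemma cayley_mult_unit:
  fixes x :: "complex^8"
  shows "cayley_mult (axis 0 1) x = x" "cayley_mult x (axis 0 1) = x"
proof -
  have "\<forall>k. cayley_mult (axis 0 1) x $ k = x $ k" "\<forall>k. cayley_mult x (axis 0 1) $ k = x $ k"
    unfolding forall_8 cayley_mult_nth axis_nth by simp_all
  then show "cayley_mult (axis 0 1) x = x" "cayley_mult x (axis 0 1) = x"
    by (simp_all add: vec_eq_iff)
qed

lemma matrix_vector_mult_axis: "(A *v axis i 1) $ j = A $ j $ i" for A :: "complex^'n^'m"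
  by (simp add: matrix_vector_mult_def axis_def if_distrib [of "\<lambda>u. _ * u"] cong: if_cong)

lemma sl3_centre_commute:
  assumes Y: "Y \<in> G2_der" "Y *v axis 1 1 = 0"
  shows "sl3_centre s ** Y = Y ** sl3_centre s"
proof -
  \<comment> \<open>A derivation kills the unit: e_0 e_0 = e_0 gives Y e_0 = 2 Y e_0.\<close>
  have "Y *v cayley_mult (axis 0 1) (axis 0 1)
      = cayley_mult (Y *v axis 0 1) (axis 0 1) + cayley_mult (axis 0 1) (Y *v axis 0 1)"
    using Y unfolding G2_der_def by blast
  then have Y0: "Y *v axis 0 1 = 0"
    by (simp only: cayley_mult_unit) simp
  \<comment> \<open>Skewness turns a zero column of Y into a zero row, so Y x has no e_0 and e_1
    components.\<close>
  have row: "(Y *v x) $ i = 0" if "Y *v axis i 1 = 0" for i x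
  proof -
    have "Y $ j $ i = 0" for j
      using that matrix_vector_mult_axis [of Y i j] by simp
    moreover have "Y $ i $ j = - Y $ j $ i" for j
    proof -
      have "transpose Y $ j $ i = (- Y) $ j $ i" using Y by (simp add: G2_der_def)
      then show ?thesis by (simp add: transpose_def)
    qed
    ultimately show ?thesis by (simp add: matrix_vector_mult_def)
  qed
  \<comment> \<open>The last two terms correct - 1/2 + s L to the identity on e_0 and e_1. Y
    annihilates these two vectors, and it commutes with L because it is a derivation with Y e_1 =
    0.\<close>
  have Z: "sl3_centre s *v x = (- 1 / 2) *s x + s *s cayley_mult (axis 1 1) x
      + (3 / 2 * x $ 0 + s * x $ 1) *s axis 0 1 + (3 / 2 * x $ 1 - s * x $ 0) *s axis 1 1" for x
  proof -
    have "\<forall>k. (sl3_centre s *v x) $ k = ((- 1 / 2) *s x + s *s cayley_mult (axis 1 1) x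
        + (3 / 2 * x $ 0 + s * x $ 1) *s axis 0 1 + (3 / 2 * x $ 1 - s * x $ 0) *s axis 1 1) $ k"
      unfolding forall_8 vector_add_component vector_smult_component cayley_mult_nth sl3_centre_nth axis_nth
      by simp
    then show ?thesis by (simp add: vec_eq_iff)
  qed
  have L: "Y *v cayley_mult (axis 1 1) x = cayley_mult (axis 1 1) (Y *v x)" for x
  proof -
    have "Y *v cayley_mult (axis 1 1) x = cayley_mult (Y *v axis 1 1) x + cayley_mult (axis 1 1) (Y *v x)"
      using Y unfolding G2_der_def by blast
    then show ?thesis
      using cayley_mult_scale_left [of 0 0 x] by (simp add: Y(2))
  qed
  have "Y *v (sl3_centre s *v x) = sl3_centre s *v (Y *v x)" for x
    unfolding Z matrix_vector_right_distrib vector_scalar_commute L Y0 Y(2)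
      row [OF Y0] row [OF Y(2)] by simp
  then show ?thesis
    by (simp add: matrix_eq matrix_vector_mul_assoc [symmetric])
qed

lemma tau_nth:
  "(tau t *v x) $ 0 = 0" "(tau t *v x) $ 1 = - \<i> * of_real t * x $ 2"
  "(tau t *v x) $ 2 = \<i> * of_real t * x $ 1" "(tau t *v x) $ 3 = 0"
  "(tau t *v x) $ 4 = \<i> * of_real t / 2 * x $ 7" "(tau t *v x) $ 5 = \<i> * of_real t / 2 * x $ 6"
  "(tau t *v x) $ 6 = - \<i> * of_real t / 2 * x $ 5" "(tau t *v x) $ 7 = - \<i> * of_real t / 2 * x $ 4"
  unfolding tau_eq mscale_vec_mult matrix_vector_mult_add_rdistrib vector_smult_component
    vector_add_component skew_diff_mult_nth
  by simp_all

lemma tau_G2_der: "tau t \<in> G2_der"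
  unfolding tau_eq
  by (intro cmat.subspace_scale cmat.subspace_add G2_der_subspace skew_diff_G2_der)

text \<open>On the complement of sl(3) in the Lie algebra, conjugation by a generator of the centre
  has the two primitive cube roots of unity as eigenvalues, and 1 + omega + omega^2 = 0.\<close>

lemma tau_sl3_centre:
  assumes s: "s * s = 3 / 4"
  shows "tau t + sl3_centre s ** tau t ** sl3_centre (- s) + sl3_centre (- s) ** tau t ** sl3_centre s = 0"
proof -
  have ss: "s * s = 3 / 4" "s * (s * z) = 3 / 4 * z" for z
    using s by (simp_all only: mult.assoc [symmetric])
  have "\<forall>k. ((tau t *v x) + (sl3_centre s *v (tau t *v (sl3_centre (- s) *v x)))
     + (sl3_centre (- s) *v (tau t *v (sl3_centre s *v x)))) $ k = 0" for x
    unfolding forall_8 vector_add_component sl3_centre_nth tau_nth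
    by (intro conjI; simp add: algebra_simps add_divide_distrib diff_divide_distrib ss)
  then show ?thesis
    by (simp add: matrix_eq matrix_vector_mult_add_rdistrib matrix_vector_mul_assoc [symmetric] vec_eq_iff)
qed

lemma killing_form_zero_left: "killing_form L 0 Y = 0"
proof -
  show ?thesis
    by (simp add: cmat.representation_zero killing_form_def trace_on_def bracket_def Let_def
       bounded_bilinear.zero_left [OF bounded_bilinear_matrix_mult]
       bounded_bilinear.zero_right [OF bounded_bilinear_matrix_mult])
qed

lemma killing_form_add_left:
  assumes "cmat.subspace L" "\<And>X Y. X \<in> L \<Longrightarrow> Y \<in> L \<Longrightarrow> bracket X Y \<in> L"
    and "X \<in> L" "X' \<in> L" "Y \<in> L"
  shows "killing_form L (X + X') Y = killing_form L X Y + killing_form L X' Y"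
proof -
  have "bracket (X + X') W = bracket X W + bracket X' W" for W
    by (simp add: bracket_def matrix_add_ldistrib matrix_add_rdistrib)
  then show ?thesis
    unfolding killing_form_def by (simp add: trace_on_add assms)
qed

theorem tau_killing_complement: "tau t \<in> killing_complement (lie_algebra G2C) (lie_algebra SL3C)"
proof -
  have "killing_form G2_der (tau t) Y = 0" if "Y \<in> lie_algebra SL3C" for Y
  proof -
    define s :: complex where "s = of_real (sqrt 3 / 2)"
    have s: "s * s = 3 / 4" "- s * - s = 3 / 4"
      unfolding s_def by (simp_all flip: of_real_mult)
    note Y = lie_algebra_SL3C [OF that]
    let ?Z = sl3_centre and ?X = "tau t"
    have conj: "?Z u ** X ** ?Z (- u) \<in> G2_der" if X: "X \<in> G2_der" and u: "u * u = 3 / 4" for X u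
      using conjugation_G2_der [of "?Z u" X] X sl3_centre_orthogonal [of u] sl3_centre_orthogonal [of "- u"] u
      by (simp add: transpose_sl3_centre sl3_centre_automorphism G2_der_def)
    have inv: "killing_form G2_der (?Z u ** ?X ** ?Z (- u)) Y = killing_form G2_der ?X Y"
      if u: "u * u = 3 / 4" for u
    proof -
      have u': "?Z (- u) ** ?Z u = mat 1" "?Z u ** ?Z (- u) = mat 1"
        using sl3_centre_orthogonal [of u] sl3_centre_orthogonal [of "- u"] u by simp_all
      have "?Z u ** Y ** ?Z (- u) = Y ** (?Z u ** ?Z (- u))"
        by (simp only: sl3_centre_commute [OF Y] matrix_mul_assoc)
      then have *: "?Z u ** Y ** ?Z (- u) = Y"
        by (simp add: u')
      have "killing_form G2_der (?Z u ** ?X ** ?Z (- u)) (?Z u ** Y ** ?Z (- u)) = killing_form G2_der ?X Y"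
        using killing_form_conjugation [OF G2_der_subspace bracket_G2_der, of "?Z u" ?X Y] conj [of _ u] conj [of _ "- u"]
        by (simp add: transpose_sl3_centre u' u Y(1) tau_G2_der)
      then show ?thesis by (simp only: *)
    qed
    let ?X1 = "?Z s ** ?X ** ?Z (- s)" and ?X2 = "?Z (- s) ** ?X ** ?Z (- (- s))"
    have mem: "?X1 \<in> G2_der" "?X2 \<in> G2_der" "?X + ?X1 \<in> G2_der"
      by (intro conj tau_G2_der s cmat.subspace_add [OF G2_der_subspace])+
    have "0 = killing_form G2_der (?X + ?X1 + ?X2) Y"
      using tau_sl3_centre [OF s(1), of t] by (simp add: killing_form_zero_left)
    also have "\<dots> = killing_form G2_der ?X Y + killing_form G2_der ?X1 Y + killing_form G2_der ?X2 Y"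
      by (simp only: killing_form_add_left [OF G2_der_subspace bracket_G2_der] mem Y(1) tau_G2_der)
    also have "\<dots> = 3 * killing_form G2_der ?X Y"
      by (simp only: inv s) simp
    finally show ?thesis by simp
  qed
  then show ?thesis
    by (simp add: killing_complement_def lie_algebra_G2C tau_G2_der)
qed

section \<open>Transitivity of the compact group\<close>

lemma matrix_vector_mult_scaleR_complex: "A *v (c *\<^sub>R x) = c *\<^sub>R (A *v x)" for A :: "complex^'n^'m"
  by (rule bounded_bilinear.scaleR_right [OF bounded_bilinear_matrix_vector_mult])

lemma mexp_rotation:
  assumes "A *v v = w" "A *v w = - v"
  shows "mexp (t *\<^sub>R A) *v v = cos t *\<^sub>R v + sin t *\<^sub>R w"
proof -
  have "((\<lambda>t. cos t *\<^sub>R v + sin t *\<^sub>R w) has_vector_derivative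
      A *v (cos t *\<^sub>R v + sin t *\<^sub>R w)) (at t)" for t
    using assms
    by (auto intro!: derivative_eq_intros simp: matrix_vector_right_distrib matrix_vector_mult_scaleR_complex)
  from mexp_ode [OF this] show ?thesis by simp
qed

lemma mexp_boost:
  assumes "A *v v = w" "A *v w = v"
  shows "mexp (t *\<^sub>R A) *v v = cosh t *\<^sub>R v + sinh t *\<^sub>R w"
proof -
  have "((\<lambda>t. cosh t *\<^sub>R v + sinh t *\<^sub>R w) has_vector_derivative
      A *v (cosh t *\<^sub>R v + sinh t *\<^sub>R w)) (at t)" for t
    using assms
    by (auto intro!: derivative_eq_intros simp: matrix_vector_right_distrib matrix_vector_mult_scaleR_complex)
  from mexp_ode [OF this] show ?thesis by simp
qed

lemma mexp_kernel:
  assumes "A *v v = 0"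
  shows "mexp (t *\<^sub>R A) *v v = v"
proof -
  have "((\<lambda>t. v) has_vector_derivative A *v v) (at t)" for t
    by (simp add: assms)
  from mexp_ode [OF this] show ?thesis by simp
qed

text \<open>Polar form cos \<open>\<theta>\<close> + n sin \<open>\<theta>\<close> of a unit
  quaternion, with n a unit imaginary quaternion; for sin \<open>\<theta>\<close> = 0 the axis n is
  arbitrary and taken to be (1, 0, 0).\<close>

lemma unit_quaternion_polar:
  fixes p q r s :: real
  assumes "p\<^sup>2 + q\<^sup>2 + r\<^sup>2 + s\<^sup>2 = 1"
  obtains \<theta> a b c where "a\<^sup>2 + b\<^sup>2 + c\<^sup>2 = 1"
    "p = cos \<theta>" "q = sin \<theta> * a" "r = sin \<theta> * b" "s = sin \<theta> * c"
proof -
  define m where "m = sqrt (q\<^sup>2 + r\<^sup>2 + s\<^sup>2)"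
  have m: "m\<^sup>2 = q\<^sup>2 + r\<^sup>2 + s\<^sup>2"
    by (simp add: m_def)
  with assms have "p\<^sup>2 + m\<^sup>2 = 1" by simp
  then obtain \<theta> where \<theta>: "p = cos \<theta>" "m = sin \<theta>"
    by (metis sincos_total_2pi)
  show thesis
  proof (cases "m = 0")
    case True
    with m have "q = 0" "r = 0" "s = 0"
      by (simp_all add: add_nonneg_eq_0_iff)
    with \<theta> True show thesis by (intro that [of 1 0 0 \<theta>]) auto
  next
    case False
    have "(q / m)\<^sup>2 + (r / m)\<^sup>2 + (s / m)\<^sup>2 = 1"
      using False by (simp add: power_divide add_divide_distrib [symmetric] m [symmetric])
    with \<theta> False show thesis by (intro that [of "q / m" "r / m" "s / m" \<theta>]) auto
  qed
qed

definition cvec :: "real^8 \<Rightarrow> complex^8" where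
  "cvec x = (\<chi> i. of_real (x $ i))"

lemma cvec_nth [simp]: "cvec x $ i = of_real (x $ i)"
  by (simp add: cvec_def)

text \<open>The subgroup fixing a quaternion subalgebra pointwise acts on the orthogonal complement
  as the unit quaternions, hence transitively on its spheres.\<close>

lemma quaternion_rotation:
  fixes x :: "real^8" and a b c d :: 8
  assumes D: "skew b a - skew d c \<in> G2_der" "skew c a - skew b d \<in> G2_der" "skew d a - skew c b \<in> G2_der"
    and dist: "distinct [a, b, c, d]"
  obtains g \<rho> where "g \<in> G2" "\<rho> \<ge> 0"
    "\<And>y. y $ a = 0 \<Longrightarrow> y $ b = 0 \<Longrightarrow> y $ c = 0 \<Longrightarrow> y $ d = 0 \<Longrightarrow> g *v y = y"
    "g *v cvec x = cvec (\<chi> i. if i = a then \<rho> else if i \<in> {b, c, d} then 0 else x $ i)"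
proof -
  have neq: "a \<noteq> b" "a \<noteq> c" "a \<noteq> d" "b \<noteq> c" "b \<noteq> d" "c \<noteq> d"
    "b \<noteq> a" "c \<noteq> a" "d \<noteq> a" "c \<noteq> b" "d \<noteq> b" "d \<noteq> c"
    using dist by auto
  define \<rho> where "\<rho> = sqrt ((x $ a)\<^sup>2 + (x $ b)\<^sup>2 + (x $ c)\<^sup>2 + (x $ d)\<^sup>2)"
  have \<rho>: "\<rho> \<ge> 0" "\<rho>\<^sup>2 = (x $ a)\<^sup>2 + (x $ b)\<^sup>2 + (x $ c)\<^sup>2 + (x $ d)\<^sup>2"
    by (simp_all add: \<rho>_def)
  let ?x0 = "cvec (\<chi> i. if i \<in> {a, b, c, d} then 0 else x $ i)"
  show thesis
  proof (cases "\<rho> = 0")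
    case True
    with \<rho> have "x $ a = 0" "x $ b = 0" "x $ c = 0" "x $ d = 0"
      by (simp_all add: add_nonneg_eq_0_iff)
    then have "cvec x = cvec (\<chi> i. if i = a then 0 else if i \<in> {b, c, d} then 0 else x $ i)"
      by (auto simp: vec_eq_iff)
    then show thesis
      by (intro that [of "mat 1" 0]) (simp_all add: G2_one)
  next
    case False
    have "(x $ a / \<rho>)\<^sup>2 + (x $ b / \<rho>)\<^sup>2 + (x $ c / \<rho>)\<^sup>2 + (x $ d / \<rho>)\<^sup>2 = 1"
      using False by (simp add: power_divide add_divide_distrib [symmetric] \<rho>(2) [symmetric])
    then obtain \<theta> p q r where pqr: "p\<^sup>2 + q\<^sup>2 + r\<^sup>2 = 1"
      and "x $ a / \<rho> = cos \<theta>" "x $ b / \<rho> = sin \<theta> * p" "x $ c / \<rho> = sin \<theta> * q" "x $ d / \<rho> = sin \<theta> * r"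
      by (rule unit_quaternion_polar)
    with False have x: "x $ a = \<rho> * cos \<theta>" "x $ b = \<rho> * (sin \<theta> * p)" "x $ c = \<rho> * (sin \<theta> * q)"
      "x $ d = \<rho> * (sin \<theta> * r)"
      by (simp_all add: field_simps)
    \<comment> \<open>The three derivations anticommute and square to -1 on the span of the four
      axes, so X is the imaginary unit with coordinates p, q, r, and its exponential rotates the
      plane of e_a and X e_a.\<close>
    define X where "X = mscale (of_real p) (skew b a - skew d c) + mscale (of_real q) (skew c a - skew b d)
      + mscale (of_real r) (skew d a - skew c b)"
    have X_G2: "X \<in> G2_der"
      unfolding X_def by (intro cmat.subspace_add cmat.subspace_scale G2_der_subspace D)
    have X_real: "X $ i $ j \<in> \<real>" for i j
      unfolding X_def mscale_def skew_def by (auto intro!: Reals_add Reals_mult Reals_diff)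
    have X_nth: "(X *v y) $ i = of_real p * ((skew b a - skew d c) *v y) $ i
        + of_real q * ((skew c a - skew b d) *v y) $ i + of_real r * ((skew d a - skew c b) *v y) $ i" for y i
      unfolding X_def by (simp add: matrix_vector_mult_add_rdistrib mscale_vec_mult)
    have X_kernel: "X *v y = 0" if "y $ a = 0" "y $ b = 0" "y $ c = 0" "y $ d = 0" for y
      unfolding vec_eq_iff X_nth skew_diff_mult_nth that if_cancel by simp
    let ?e = "axis a 1 :: complex^8"
    let ?n = "of_real p *s axis b 1 + of_real q *s axis c 1 + of_real r *s axis d 1 :: complex^8"
    have "X *v ?e = ?n"
      unfolding vec_eq_iff X_nth skew_diff_mult_nth vector_add_component vector_smult_component axis_nth
      using neq by simp
    moreover have "X *v ?n = - ?e"
    proof -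
      have "complex_of_real p * of_real p + of_real q * of_real q + of_real r * of_real r = 1"
        using pqr unfolding power2_eq_square by (metis of_real_1 of_real_add of_real_mult)
      then show ?thesis
        unfolding vec_eq_iff X_nth skew_diff_mult_nth vector_add_component vector_smult_component
          axis_nth vector_uminus_component
        using neq by (auto simp: algebra_simps)
    qed
    ultimately have rot: "mexp (\<theta> *\<^sub>R X) *v ?e = cos \<theta> *\<^sub>R ?e + sin \<theta> *\<^sub>R ?n"
      by (rule mexp_rotation)
    \<comment> \<open>The part \<open>?x0\<close> off the four coordinates is fixed by the flow; the
      rest is \<open>\<rho>\<close> times e_a rotated by \<open>\<theta>\<close>. Flowing back for
      time \<open>\<theta>\<close> therefore leaves only the a-th of the four coordinates.\<close>
    have "cvec x = ?x0 + \<rho> *\<^sub>R (cos \<theta> *\<^sub>R ?e + sin \<theta> *\<^sub>R ?n)"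
      unfolding vec_eq_iff vector_add_component vector_smult_component vector_scaleR_component axis_nth cvec_nth
      using neq by (auto simp: x scaleR_conv_of_real)
    also have "\<dots> = ?x0 + mexp (\<theta> *\<^sub>R X) *v (\<rho> *\<^sub>R ?e)"
      by (simp only: rot matrix_vector_mult_scaleR_complex)
    finally have "mexp (- \<theta> *\<^sub>R X) *v cvec x = mexp (- \<theta> *\<^sub>R X) *v ?x0 + (mexp (- \<theta> *\<^sub>R X) ** mexp (\<theta> *\<^sub>R X)) *v (\<rho> *\<^sub>R ?e)"
      by (simp only: matrix_vector_right_distrib matrix_vector_mul_assoc)
    also have "\<dots> = ?x0 + \<rho> *\<^sub>R ?e"
      by (simp only: mexp_inverse matrix_vector_mul_lid, subst mexp_kernel) (auto intro!: X_kernel)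
    also have "\<dots> = cvec (\<chi> i. if i = a then \<rho> else if i \<in> {b, c, d} then 0 else x $ i)"
      unfolding vec_eq_iff vector_add_component vector_scaleR_component axis_nth cvec_nth
      using neq by (auto simp: scaleR_conv_of_real)
    finally show thesis
      by (intro that [of "mexp (- \<theta> *\<^sub>R X)" \<rho>] G2_der_mexp_real X_G2 X_real \<rho>(1) mexp_kernel X_kernel)
  qed
qed

text \<open>Three collapses: coordinates 4 to 7 onto 4, then 2 to 5 onto 2, then 1, 2, 5, 6 onto 1.
  None brings back an index cleared outside its own set.\<close>

lemma G2_to_axis_1:
  assumes "x $ 0 = 0"
  obtains g \<rho> where "g \<in> G2" "\<rho> \<ge> 0" "g *v cvec x = cvec (\<chi> i. if i = 1 then \<rho> else 0)"
proof -
  \<comment> \<open>The numerals instantiate b, a, d, c in this order, so the second one names the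
    surviving coordinate.\<close>
  obtain g \<rho> where g: "g \<in> G2" and
    gx: "g *v cvec x = cvec (\<chi> i. if i = 4 then \<rho> else if i \<in> {5, 6, 7} then 0 else x $ i)"
    by (rule quaternion_rotation [of 5 4 7 6 x]) (auto intro: skew_diff_G2_der)
  define y where "y = (\<chi> i. if i = 4 then \<rho> else if i \<in> {5, 6, 7} then 0 else x $ i)"
  obtain g' \<rho>' where g': "g' \<in> G2" and
    gy: "g' *v cvec y = cvec (\<chi> i. if i = 2 then \<rho>' else if i \<in> {3, 4, 5} then 0 else y $ i)"
    by (rule quaternion_rotation [of 3 2 5 4 y]) (auto intro: skew_diff_G2_der)
  define z where "z = (\<chi> i. if i = 2 then \<rho>' else if i \<in> {3, 4, 5} then 0 else y $ i)"
  obtain g'' \<rho>'' where g'': "g'' \<in> G2" "\<rho>'' \<ge> 0" and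
    gz: "g'' *v cvec z = cvec (\<chi> i. if i = 1 then \<rho>'' else if i \<in> {2, 5, 6} then 0 else z $ i)"
    by (rule quaternion_rotation [of 2 1 6 5 z]) (auto intro: skew_diff_G2_der)
  have *: "\<forall>i. (\<chi> i. if i = 1 then \<rho>'' else if i \<in> {2, 5, 6} then 0 else z $ i) $ i
      = (\<chi> i. if i = 1 then \<rho>'' else 0) $ i"
    unfolding forall_8 by (simp add: z_def y_def assms)
  have "(g'' ** (g' ** g)) *v cvec x = cvec (\<chi> i. if i = 1 then \<rho>'' else 0)"
    using gx gy gz *
    unfolding matrix_vector_mul_assoc [symmetric] y_def [symmetric] z_def [symmetric]
    by (simp only: vec_eq_iff [symmetric])
  then show thesis
    by (intro that [of "g'' ** (g' ** g)" \<rho>''] G2_mult g g' g'')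
qed

text \<open>The quaternion subalgebras fixed by the two rotations, on indices 0, 1, 2, 3 and 0, 1,
  6, 7, both contain e_1.\<close>

lemma G2_fix_axis_1_to_axis_2:
  assumes "x $ 0 = 0" "x $ 1 = 0"
  obtains g \<rho> where "g \<in> G2" "\<rho> \<ge> 0" "\<And>c. g *v (c *s axis 1 1) = c *s axis 1 1"
    "g *v cvec x = cvec (\<chi> i. if i = 2 then \<rho> else 0)"
proof -
  obtain g \<rho> where g: "g \<in> G2"
    and fix1: "\<And>y. y $ 4 = 0 \<Longrightarrow> y $ 5 = 0 \<Longrightarrow> y $ 6 = 0 \<Longrightarrow> y $ 7 = 0 \<Longrightarrow> g *v y = y" and
    gx: "g *v cvec x = cvec (\<chi> i. if i = 4 then \<rho> else if i \<in> {5, 6, 7} then 0 else x $ i)"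
    by (rule quaternion_rotation [of 5 4 7 6 x]) (auto intro: skew_diff_G2_der)
  define y where "y = (\<chi> i. if i = 4 then \<rho> else if i \<in> {5, 6, 7} then 0 else x $ i)"
  obtain g' \<rho>' where g': "g' \<in> G2" "\<rho>' \<ge> 0"
    and fix2: "\<And>y. y $ 2 = 0 \<Longrightarrow> y $ 3 = 0 \<Longrightarrow> y $ 4 = 0 \<Longrightarrow> y $ 5 = 0 \<Longrightarrow> g' *v y = y" and
    gy: "g' *v cvec y = cvec (\<chi> i. if i = 2 then \<rho>' else if i \<in> {3, 4, 5} then 0 else y $ i)"
    by (rule quaternion_rotation [of 3 2 5 4 y]) (auto intro: skew_diff_G2_der)
  have *: "\<forall>i. (\<chi> i. if i = 2 then \<rho>' else if i \<in> {3, 4, 5} then 0 else y $ i) $ i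
      = (\<chi> i. if i = 2 then \<rho>' else 0) $ i"
    unfolding forall_8 by (simp add: y_def assms)
  have "(g' ** g) *v cvec x = cvec (\<chi> i. if i = 2 then \<rho>' else 0)"
    using gx gy *
    unfolding matrix_vector_mul_assoc [symmetric] y_def [symmetric] by (simp only: vec_eq_iff [symmetric])
  moreover have "(g' ** g) *v (c *s axis 1 1) = c *s axis 1 1" for c
    unfolding matrix_vector_mul_assoc [symmetric]
    by (subst fix1) (auto simp: axis_nth fix2)
  ultimately show thesis
    by (intro that [of "g' ** g" \<rho>'] G2_mult g g')
qed

section \<open>The decomposition\<close>

lemma G2C_axis_1:
  assumes g: "g \<in> G2C"
  shows "(g *v axis 1 1) $ 0 = 0" "(\<Sum>i\<in>UNIV. ((g *v axis 1 1) $ i)\<^sup>2) = 1"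
proof -
  \<comment> \<open>g e_0 acts as a left unit on the image of g. Since g is onto, e_0 lies in that
    image, and multiplying it by g e_0 gives g e_0 = e_0.\<close>
  have "cayley_mult (g *v axis 0 1) (g *v (transpose g *v axis 0 1)) = g *v (transpose g *v axis 0 1)"
    using g by (simp add: G2C_def cayley_mult_unit del: transpose_matrix_vector)
  then have "g *v axis 0 1 = axis 0 1"
    by (simp only: matrix_vector_mul_assoc G2C_transpose_mult [OF g] matrix_vector_mul_lid cayley_mult_unit)
  then have e0: "g $ k $ 0 = (if k = 0 then 1 else 0)" for k
    using matrix_vector_mult_axis [of g 0 k] by (simp add: axis_nth)
  have orth: "(\<Sum>k\<in>UNIV. g $ k $ i * g $ k $ j) = (if i = j then 1 else 0)" for i j
  proof -
    have "(transpose g ** g) $ i $ j = (mat 1 :: complex^8^8) $ i $ j"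
      by (simp only: G2C_transpose_mult [OF g])
    then show ?thesis by (simp add: matrix_matrix_mult_def transpose_def mat_def)
  qed
  have "g $ 0 $ 1 = 0"
    using orth [of 0 1] by (simp add: e0 if_distrib [of "\<lambda>u. u * _"] cong: if_cong)
  then show "(g *v axis 1 1) $ 0 = 0"
    by (simp add: matrix_vector_mult_axis)
  show "(\<Sum>i\<in>UNIV. ((g *v axis 1 1) $ i)\<^sup>2) = 1"
    using orth [of 1 1] by (simp add: matrix_vector_mult_axis power2_eq_square)
qed

lemma G2C_axis_1_normal_form:
  assumes g: "g \<in> G2C"
  obtains w t where "w \<in> G2" "w *v (g *v axis 1 1) = cosh t *\<^sub>R axis 1 1 + sinh t *\<^sub>R (\<i> *s axis 2 1)"
proof -
  have split: "v = cvec (\<chi> i. Re (v $ i)) + \<i> *s cvec (\<chi> i. Im (v $ i))" for v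
    by (simp add: vec_eq_iff complex_eq_iff)
  have G2_G2C: "w \<in> G2 \<Longrightarrow> w \<in> G2C" for w by (simp add: G2_eq)
  define v where "v = g *v axis 1 1"
  have "(\<chi> i. Re (v $ i)) $ 0 = 0"
    by (simp add: v_def G2C_axis_1 [OF g])
  then obtain u \<rho> where u: "u \<in> G2" "\<rho> \<ge> 0"
    "u *v cvec (\<chi> i. Re (v $ i)) = cvec (\<chi> i. if i = 1 then \<rho> else 0)"
    by (rule G2_to_axis_1)
  define y where "y = (\<chi> i. Im ((u *v v) $ i))"
  have real: "(u *v cvec x) $ i \<in> \<real>" for x i
    using u(1) by (simp add: G2_eq matrix_vector_mult_def)
  have uv: "u *v v = \<rho> *\<^sub>R axis 1 1 + \<i> *s cvec y"
  proof -
    have *: "u *v v = cvec (\<chi> i. if i = 1 then \<rho> else 0) + \<i> *s (u *v cvec (\<chi> i. Im (v $ i)))"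
      by (subst split [of v]) (simp only: matrix_vector_right_distrib vector_scalar_commute u(3))
    \<comment> \<open>As u is a real matrix, real and imaginary parts of v are moved
      separately.\<close>
    have "Re ((u *v v) $ i) = (if i = 1 then \<rho> else 0)" for i
      unfolding * using real [of "\<chi> i. Im (v $ i)" i] by (simp add: complex_is_Real_iff)
    then show ?thesis
      by (subst split [of "u *v v"])
        (simp add: y_def vec_eq_iff axis_nth scaleR_conv_of_real [where 'a = complex])
  qed
  have ug: "u *v v = (u ** g) *v axis 1 1"
    by (simp add: v_def matrix_vector_mul_assoc)
  note orbit = G2C_axis_1 [OF G2C_mult [OF G2_G2C [OF u(1)] g], folded ug, unfolded uv]
  have y0: "y $ 0 = 0"
    using orbit(1) by (simp add: axis_nth)
  \<comment> \<open>Real and imaginary parts of the equation that the squares of the coordinates sum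
    to 1. The first forces \<open>\<rho>\<close> to be nonzero, so the second makes y orthogonal to
    e_1.\<close>
  have "\<rho>\<^sup>2 = 1 + ((y $ 1)\<^sup>2 + (y $ 2)\<^sup>2 + (y $ 3)\<^sup>2 + (y $ 4)\<^sup>2 + (y $ 5)\<^sup>2 + (y $ 6)\<^sup>2 + (y $ 7)\<^sup>2)"
    (is "_ = 1 + ?S") and y1: "\<rho> * y $ 1 = 0"
    using orbit(2) unfolding sum_8 complex_eq_iff
    by (simp_all add: axis_nth y0 power2_eq_square)
  moreover have "?S \<ge> 0"
    by (intro add_nonneg_nonneg zero_le_power2)
  ultimately have "\<rho>\<^sup>2 > 0"
    by linarith
  with y1 have y1: "y $ 1 = 0" by auto
  obtain u' \<sigma> where u': "u' \<in> G2" "\<sigma> \<ge> 0" "\<And>c. u' *v (c *s axis 1 1) = c *s axis 1 1"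
    "u' *v cvec y = cvec (\<chi> i. if i = 2 then \<sigma> else 0)"
    by (rule G2_fix_axis_1_to_axis_2 [OF y0 y1]) blast
  have sc: "\<rho> *\<^sub>R axis i 1 = (of_real \<rho> *s axis i 1 :: complex^8)" for \<rho> i
    unfolding vec_eq_iff vector_scaleR_component vector_smult_component
    by (simp add: scaleR_conv_of_real [where 'a = complex])
  have "u' *v (u *v v) = \<rho> *\<^sub>R axis 1 1 + \<i> *s cvec (\<chi> i. if i = 2 then \<sigma> else 0)"
    unfolding uv sc matrix_vector_right_distrib vector_scalar_commute [of _ \<i>] u'(3,4) ..
  also have "cvec (\<chi> i. if i = 2 then \<sigma> else 0) = \<sigma> *\<^sub>R axis 2 1"
    by (simp add: sc vec_eq_iff axis_nth)
  finally have *: "(u' ** u) *v v = \<rho> *\<^sub>R axis 1 1 + \<sigma> *\<^sub>R (\<i> *s axis 2 1)"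
    by (simp add: matrix_vector_mul_assoc sc vec_eq_iff scaleR_conv_of_real [where 'a = complex])
  have "(u' ** u) *v v = ((u' ** u) ** g) *v axis 1 1"
    by (simp add: v_def matrix_vector_mul_assoc)
  \<comment> \<open>The same quadratic equation at the final vector relates \<open>\<rho>\<close>
    and \<open>\<sigma>\<close>, without following the length of y through the rotation.\<close>
  note orbit = G2C_axis_1 [OF G2C_mult [OF G2_G2C [OF G2_mult [OF u'(1) u(1)]] g], folded this, unfolded *]
  have "\<rho>\<^sup>2 = 1 + \<sigma>\<^sup>2"
    using orbit(2) unfolding sum_8 complex_eq_iff
    by (simp add: axis_nth power2_eq_square)
  \<comment> \<open>Here \<open>\<rho>\<close> >= 0 selects the branch of the hyperbola on which
    cosh takes its values.\<close>
  then have "cosh (arsinh \<sigma>) = \<rho>"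
    using u(2) by (simp add: cosh_arsinh_real real_sqrt_unique add.commute)
  with * show thesis
    by (intro that [of "u' ** u" "arsinh \<sigma>"] G2_mult u'(1) u(1)) (simp add: v_def)
qed

section \<open>The one-parameter group generated by \<open>tau 1\<close>\<close>

lemma tau_scaleR: "tau t = t *\<^sub>R tau 1"
  by (simp add: tau_eq scaleR_eq_mscale mult.assoc)

lemma tau_inject: "s *\<^sub>R tau 1 = t *\<^sub>R tau 1 \<longleftrightarrow> s = t"
proof
  assume "s *\<^sub>R tau 1 = t *\<^sub>R tau 1"
  then have "(tau s *v axis 1 1) $ 2 = (tau t *v axis 1 1) $ 2"
    by (simp only: tau_scaleR [symmetric])
  then show "s = t" by (simp add: tau_nth axis_nth)
qed simp

lemma mexp_tau_axis_1:
  "mexp (t *\<^sub>R tau 1) *v axis 1 1 = cosh t *\<^sub>R axis 1 1 + sinh t *\<^sub>R (\<i> *s axis 2 1)"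
proof (rule mexp_boost)
  have "\<forall>k. (tau 1 *v axis 1 1) $ k = (\<i> *s axis 2 1) $ k"
    "\<forall>k. (tau 1 *v (\<i> *s axis 2 1)) $ k = axis 1 1 $ k"
    unfolding forall_8 tau_nth vector_smult_component axis_nth by simp_all
  then show "tau 1 *v axis 1 1 = \<i> *s axis 2 1" "tau 1 *v (\<i> *s axis 2 1) = axis 1 1"
    by (simp_all add: vec_eq_iff)
qed

lemma \<aa>\<^sub>1_eq: "\<aa>\<^sub>1 = range (\<lambda>t. t *\<^sub>R tau 1)"
  unfolding \<aa>\<^sub>1_def by (rule image_cong [OF refl tau_scaleR])

lemma A\<^sub>1_eq: "A\<^sub>1 = range (\<lambda>t. mexp (t *\<^sub>R tau 1))"
  by (simp only: A\<^sub>1_def \<aa>\<^sub>1_eq image_image)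

lemma A\<^sub>1_G2C: "A\<^sub>1 \<subseteq> G2C"
  by (auto simp: A\<^sub>1_eq intro!: G2_der_mexp tau_G2_der)

lemma comm_group_A\<^sub>1: "comm_group \<lparr>carrier = A\<^sub>1, mult = (**), one = mat 1\<rparr>"
proof (rule comm_groupI; simp only: monoid.simps partial_object.simps)
  fix x y z assume "x \<in> A\<^sub>1" "y \<in> A\<^sub>1"
  then obtain s t where xy: "x = mexp (s *\<^sub>R tau 1)" "y = mexp (t *\<^sub>R tau 1)"
    by (auto simp: A\<^sub>1_eq)
  show "x ** y \<in> A\<^sub>1"
    unfolding xy mexp_add [symmetric] A\<^sub>1_eq by (rule rangeI)
  show "x ** y = y ** x"
    unfolding xy mexp_add [symmetric] by (simp only: add.commute)
  show "x ** y ** z = x ** (y ** z)"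
    by (simp only: matrix_mul_assoc)
next
  show "mat 1 \<in> A\<^sub>1"
    unfolding A\<^sub>1_eq by (rule range_eqI [of _ _ 0]) simp
next
  fix x assume "x \<in> A\<^sub>1"
  then obtain t where x: "x = mexp (t *\<^sub>R tau 1)"
    by (auto simp: A\<^sub>1_eq)
  show "\<exists>y\<in>A\<^sub>1. y ** x = mat 1"
    unfolding x A\<^sub>1_eq using mexp_inverse [of t "tau 1"] by blast
  show "mat 1 ** x = x"
    by simp
qed

text \<open>For the harder inclusion, membership only provides for each t some s with exp(tX) =
  exp(s \<open>tau 1\<close>), with no regularity in t. The orbit of e_1 recovers s as arsinh of a
  coordinate of exp(tX) e_1, so s depends differentiably on t, and the chain rule at 0 makes X a
  multiple of \<open>tau 1\<close>.\<close>

lemma lie_algebra_A\<^sub>1: "lie_algebra A\<^sub>1 = \<aa>\<^sub>1"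
proof
  show "\<aa>\<^sub>1 \<subseteq> lie_algebra A\<^sub>1"
  proof
    fix X assume "X \<in> \<aa>\<^sub>1"
    then obtain s where "X = s *\<^sub>R tau 1"
      by (auto simp: \<aa>\<^sub>1_eq)
    then show "X \<in> lie_algebra A\<^sub>1"
      by (auto simp: lie_algebra_def A\<^sub>1_eq)
  qed
  show "lie_algebra A\<^sub>1 \<subseteq> \<aa>\<^sub>1"
  proof
    fix X assume X: "X \<in> lie_algebra A\<^sub>1"
    define f where "f t = Im ((mexp (t *\<^sub>R X) *v axis 1 1) $ 2)" for t
    have eq: "mexp (t *\<^sub>R X) = mexp (arsinh (f t) *\<^sub>R tau 1)" for t
    proof -
      from X obtain s where s: "mexp (t *\<^sub>R X) = mexp (s *\<^sub>R tau 1)"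
        by (auto simp: lie_algebra_def A\<^sub>1_eq)
      have "f t = sinh s"
        unfolding f_def s mexp_tau_axis_1 by (simp add: axis_nth)
      then show ?thesis by (simp add: s arsinh_sinh_real)
    qed
    let ?c = "Im ((X *v axis 1 1) $ 2)"
    have "bounded_linear (\<lambda>v :: complex^8. Im (v $ 2))"
      by (intro bounded_linear_compose [OF bounded_linear_Im] bounded_linear_vec_nth)
    from bounded_linear.has_vector_derivative [OF this mexp_vector_has_vector_derivative_0]
    have "(f has_field_derivative ?c) (at 0)"
      unfolding f_def has_real_derivative_iff_has_vector_derivative .
    moreover have "f 0 = 0"
      by (simp add: f_def axis_nth)
    ultimately have "((\<lambda>t. arsinh (f t)) has_vector_derivative ?c) (at 0)"
      unfolding has_real_derivative_iff_has_vector_derivative [symmetric]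
      using DERIV_chain2 [OF arsinh_real_has_field_derivative, of f ?c 0] by simp
    moreover have "((\<lambda>t. mexp (t *\<^sub>R tau 1)) has_vector_derivative tau 1) (at (arsinh (f 0)))"
      using mexp_has_vector_derivative_0 [of "tau 1"] by (simp only: \<open>f 0 = 0\<close> arsinh_0)
    ultimately have "((\<lambda>t. mexp (t *\<^sub>R tau 1)) \<circ> (\<lambda>t. arsinh (f t)) has_vector_derivative ?c *\<^sub>R tau 1) (at 0)"
      by (rule vector_diff_chain_at)
    then have "((\<lambda>t. mexp (t *\<^sub>R X)) has_vector_derivative ?c *\<^sub>R tau 1) (at 0)"
      by (simp only: o_def eq)
    from vector_derivative_unique_at [OF this mexp_has_vector_derivative_0, symmetric]
    have "X = ?c *\<^sub>R tau 1" .
    then show "X \<in> \<aa>\<^sub>1"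
      unfolding \<aa>\<^sub>1_eq by (rule range_eqI)
  qed
qed

lemma \<aa>\<^sub>1_eq_span: "\<aa>\<^sub>1 = span {tau 1}"
  by (simp only: \<aa>\<^sub>1_eq span_singleton)

lemma dim_\<aa>\<^sub>1: "dim \<aa>\<^sub>1 = 1"
proof -
  have "tau 1 \<noteq> 0"
    using tau_inject [of 1 0] by auto
  then show ?thesis
    unfolding \<aa>\<^sub>1_eq_span dim_span by (simp add: dim_eq_card_independent)
qed

text \<open>The factor - \<open>\<i>\<close> cancels the \<open>\<i>\<close> of
  \<open>tau_eq\<close> and leaves a real multiple of a sum of real derivations, whose exponentials
  are real.\<close>

lemma tau_compact: "tau t \<in> mscale \<i> ` lie_algebra G2"
proof
  show "tau t = mscale \<i> (mscale (- \<i>) (tau t))"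
    by simp
  have real: "mscale (- \<i>) (tau t) $ i $ j \<in> \<real>" for i j
  proof -
    have "- \<i> * (of_real t * \<i> / 2) = of_real (t / 2)"
      by (simp add: complex_eq_iff)
    then have "mscale (- \<i>) (tau t) = mscale (of_real (t / 2)) ((skew 2 1 - skew 7 4) + (skew 2 1 - skew 6 5))"
      by (simp only: tau_eq cmat.scale_scale)
    then show ?thesis
      by (simp add: mscale_def skew_def)
  qed
  have "mscale (- \<i>) (tau t) \<in> G2_der"
    by (intro cmat.subspace_scale G2_der_subspace tau_G2_der)
  then show "mscale (- \<i>) (tau t) \<in> lie_algebra G2"
    unfolding lie_algebra_def by (intro CollectI allI G2_der_mexp_real real)
qed

lemma G2C_decomposition: "G2C = {u ** a ** h | u a h. u \<in> G2 \<and> a \<in> A\<^sub>1 \<and> h \<in> SL3C}"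
proof
  show "{u ** a ** h | u a h. u \<in> G2 \<and> a \<in> A\<^sub>1 \<and> h \<in> SL3C} \<subseteq> G2C"
    using A\<^sub>1_G2C by (auto simp: G2_eq SL3C_def intro!: G2C_mult)
  show "G2C \<subseteq> {u ** a ** h | u a h. u \<in> G2 \<and> a \<in> A\<^sub>1 \<and> h \<in> SL3C}"
  proof
    fix g assume g: "g \<in> G2C"
    obtain w t where w: "w \<in> G2" "w *v (g *v axis 1 1) = mexp (t *\<^sub>R tau 1) *v axis 1 1"
      using G2C_axis_1_normal_form [OF g] by (metis mexp_tau_axis_1)
    let ?a = "mexp (t *\<^sub>R tau 1)" and ?b = "mexp (- t *\<^sub>R tau 1)"
    have ab: "?a ** ?b = mat 1" "?b ** ?a = mat 1"
      using mexp_inverse [of t "tau 1"] mexp_inverse [of "- t" "tau 1"] by simp_all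
    have wC: "w \<in> G2C" using w(1) by (simp add: G2_eq)
    \<comment> \<open>The inverse boost carries w g e_1 back to e_1, which makes
      \<open>?b ** (w ** g)\<close> the \<open>SL3C\<close> factor; solving for g leaves the inverse
      of w as the compact factor.\<close>
    have "?b ** (w ** g) *v axis 1 1 = ?b ** ?a *v axis 1 1"
      by (simp only: matrix_vector_mul_assoc [symmetric] w(2))
    then have "?b ** (w ** g) *v axis 1 1 = axis 1 1"
      by (simp only: ab matrix_vector_mul_lid)
    moreover have "?b ** (w ** g) \<in> G2C"
      by (intro G2C_mult G2_der_mexp tau_G2_der wC g)
    ultimately have h: "?b ** (w ** g) \<in> SL3C"
      unfolding SL3C_def by blast
    have "transpose w ** ?a ** (?b ** (w ** g)) = transpose w ** (?a ** ?b) ** w ** g"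
      by (simp only: matrix_mul_assoc)
    also have "\<dots> = g"
      by (simp only: ab G2C_transpose_mult [OF wC] matrix_mul_lid matrix_mul_rid)
    finally have "g = transpose w ** ?a ** (?b ** (w ** g))" ..
    moreover have "?a \<in> A\<^sub>1" by (simp add: A\<^sub>1_eq)
    ultimately show "g \<in> {u ** a ** h | u a h. u \<in> G2 \<and> a \<in> A\<^sub>1 \<and> h \<in> SL3C}"
      using G2_transpose [OF w(1)] h by blast
  qed
qed

lemma subspace_\<aa>\<^sub>1: "subspace \<aa>\<^sub>1"
  unfolding \<aa>\<^sub>1_eq_span by (rule subspace_span)

lemma \<aa>\<^sub>1_subset: "\<aa>\<^sub>1 \<subseteq> (mscale \<i> ` lie_algebra G2) \<inter> killing_complement (lie_algebra G2C) (lie_algebra SL3C)"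
  unfolding \<aa>\<^sub>1_def using tau_compact tau_killing_complement by blast

theorem theorem3p6:
  fixes GC HC Gu \<gg> \<hh> \<gg>u \<qq> :: "(complex^8^8) set"
  assumes "GC = G2C" and "HC = SL3C" and "Gu = G2"
    and "\<gg> = lie_algebra GC" and "\<hh> = lie_algebra HC" and "\<gg>u = lie_algebra Gu"
    and "\<qq> = killing_complement \<gg> \<hh>"
  shows "subspace \<aa>\<^sub>1 \<and> dim \<aa>\<^sub>1 = 1
    \<and> \<aa>\<^sub>1 \<subseteq> (mscale \<i> ` \<gg>u) \<inter> \<qq>
    \<and> comm_group \<lparr>carrier = A\<^sub>1, mult = (**), one = mat 1\<rparr>
    \<and> dim (lie_algebra A\<^sub>1) = 1
    \<and> GC = {u ** a ** h | u a h. u \<in> Gu \<and> a \<in> A\<^sub>1 \<and> h \<in> HC}"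
  unfolding assms lie_algebra_A\<^sub>1
  by (intro conjI subspace_\<aa>\<^sub>1 dim_\<aa>\<^sub>1 \<aa>\<^sub>1_subset comm_group_A\<^sub>1 G2C_decomposition)

end
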